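(* Let $d\ge 3$ be odd, and for a positive integer $n$ let $V_n:=(\mathbb{C}^n)^{\otimes d}$. Let $k$ be a positive integer and let $\pmb{\lambda}=(\lambda^{(1)},\ldots,\lambda^{(d)})$ be a $d$-tuple of partitions with $\pmb{\lambda}\subseteq(k^{d-1}\times k)^d$, i.e. each $\lambda^{(i)}$ has at most $k^{d-1}$ parts, all at most $k$. If the map $$L_k:\ \mathrm{HWV}_{\pmb{\lambda}'}\bigwedge V_k\longrightarrow\mathrm{HWV}_{(\rho_k\pmb{\lambda})'}\bigwedge V_k,\qquad L_k(v)=\omega_{d,k}\wedge v,$$ is injective, then for each integer $\ell>k$ the map $$L_\ell:\ \mathrm{HWV}_{\pmb{\lambda}'}\bigwedge V_\ell\longrightarrow\mathrm{HWV}_{(\rho_\ell\pmb{\lambda})'}\bigwedge V_\ell,\qquad L_\ell(v)=\omega_{d,\ell}\wedge v,$$ is also injective.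
   Context: $\lambda'$ denotes the conjugate partition (componentwise on tuples). For a partition $\lambda$ with parts at most $n$, $\rho_n\lambda=(n,\lambda_1,\lambda_2,\ldots)$ adds a first part equal to $n$; on tuples it acts componentwise. For each $n$, the group $\mathrm{GL}(n)^{\times d}$ acts on $V_n$ multilinearly and hence on $\bigwedge V_n$. A vector $v\in\bigwedge V_n$ is a weight vector of weight $\pmb{\mu}=(\mu^{(1)},\ldots,\mu^{(d)})$, $\mu^{(j)}\in\mathbb{Z}^n$, if every tuple of diagonal matrices $(\mathrm{diag}(a^{(1)}_1,\ldots,a^{(1)}_n),\ldots,\mathrm{diag}(a^{(d)}_1,\ldots,a^{(d)}_n))$ acts on $v$ as the scalar $\prod_j\prod_i (a^{(j)}_i)^{\mu^{(j)}_i}$. $\mathrm{HWV}_{\pmb{\mu}}\bigwedge V_n$ is the space consisting of $0$ and the nonzero weight vectors of weight $\pmb{\mu}$ invariant under $U(n)^{\times d}$, with $U(n)$ the group of upper unitriangular matrices. Partitions of length at most $n$ are padded with zeros to vectors in $\mathbb{Z}^n$. The Cayley form is $$\omega_{d,n}=\sum_{\pi_1,\ldots,\pi_d\in S_n}\mathrm{sgn}(\pi_1\cdots\pi_d)\bigwedge_{i=1}^n \left(e_{\pi_1(i)}\otimes\cdots\otimes e_{\pi_d(i)}\right)\in\bigwedge^n V_n,$$ where $e_1,\ldots,e_n$ is the standard basis of $\mathbb{C}^n$. *)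

theory Defs
  imports
    "HOL-Library.List_Lexorder"
    "HOL-Library.FuncSet"
    "HOL-Combinatorics.Permutations"
    "Jordan_Normal_Form.Matrix"
begin

section \<open>Exterior algebras\<close>

text \<open>
  Let \<open>W\<close> be the complex vector space with basis \<open>(b\<^sub>i)\<close>, \<open>i \<in> I\<close>, for a finite linearly ordered
  index set \<open>I\<close>. The products \<open>b\<^sub>S = b\<^sub>s\<^sub>1 \<and> \<dots> \<and> b\<^sub>s\<^sub>m\<close>, with
  \<open>S = {s\<^sub>1 < \<dots> < s\<^sub>m} \<subseteq> I\<close>, form a basis of the exterior algebra of \<open>W\<close>. An element of the exterior
  algebra is represented by its coefficient function \<open>S \<mapsto> v S\<close> in this basis, an element of \<open>W\<close>
  by its coordinate function on \<open>I\<close>.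
\<close>

type_synonym 'a ext = "'a set \<Rightarrow> complex"

definition ext_algebra :: "'a set \<Rightarrow> 'a ext set" where
  "ext_algebra I = {v. \<forall>S. \<not> S \<subseteq> I \<longrightarrow> v S = 0}"

definition ext_one :: "'a ext" where
  "ext_one = (\<lambda>S. if S = {} then 1 else 0)"

definition ext_vector :: "('a \<Rightarrow> complex) \<Rightarrow> 'a ext" where
  "ext_vector x = (\<lambda>S. if is_singleton S then x (the_elem S) else 0)"

text \<open>
  For disjoint \<open>S\<close> and \<open>T\<close>, sorting the factors of \<open>b\<^sub>S \<and> b\<^sub>T\<close> costs one sign for every pair
  \<open>(s, t) \<in> S \<times> T\<close> with \<open>t < s\<close>; for non-disjoint \<open>S\<close> and \<open>T\<close> the product vanishes.
\<close>

definition wedge :: "'a::linorder ext \<Rightarrow> 'a ext \<Rightarrow> 'a ext" where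
  "wedge v w = (\<lambda>R. \<Sum>S\<in>Pow R.
     (-1) ^ card {(s, t). s \<in> S \<and> t \<in> R - S \<and> t < s} * v S * w (R - S))"

definition wedge_list :: "'a::linorder ext list \<Rightarrow> 'a ext" where
  "wedge_list vs = foldr wedge vs ext_one"

text \<open>
  The algebra endomorphism of the exterior algebra induced by the linear map \<open>W \<rightarrow> W\<close> sending
  \<open>b\<^sub>i\<close> to \<open>f i\<close>.
\<close>

definition ext_map :: "'a set \<Rightarrow> ('a::linorder \<Rightarrow> 'a \<Rightarrow> complex) \<Rightarrow> 'a ext \<Rightarrow> 'a ext" where
  "ext_map I f v = (\<lambda>R. \<Sum>S\<in>Pow I.
     v S * wedge_list (map (\<lambda>i. ext_vector (f i)) (sorted_list_of_set S)) R)"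


section \<open>The tensor power and the action of the general linear groups\<close>

text \<open>
  The space \<open>V\<^sub>n\<close>, the \<open>d\<close>-fold tensor power of \<open>n\<close>-dimensional complex space, has the basis of all
  \<open>e\<^sub>J\<^sub>1 \<otimes> \<dots> \<otimes> e\<^sub>J\<^sub>d\<close>, indexed by lists \<open>J\<close> of length \<open>d\<close> with entries below \<open>n\<close>
  (standard basis vectors are numbered from \<open>0\<close>). These lists are ordered lexicographically.
\<close>

definition tensor_index :: "nat \<Rightarrow> nat \<Rightarrow> nat list set" where
  "tensor_index d n = {J. length J = d \<and> set J \<subseteq> {..<n}}"

text \<open>The coordinates of the pure tensor \<open>xs ! 0 \<otimes> \<dots> \<otimes> xs ! (d - 1)\<close>.\<close>

definition pure_tensor :: "nat \<Rightarrow> nat \<Rightarrow> complex vec list \<Rightarrow> nat list \<Rightarrow> complex" where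
  "pure_tensor d n xs = (\<lambda>J. if J \<in> tensor_index d n then \<Prod>j<d. (xs ! j) $ (J ! j) else 0)"

abbreviation ext_tensor :: "nat \<Rightarrow> nat \<Rightarrow> nat list ext set" where
  "ext_tensor d n \<equiv> ext_algebra (tensor_index d n)"

text \<open>
  A tuple \<open>(g\<^sub>1, \<dots>, g\<^sub>d)\<close> sends \<open>e\<^sub>J\<^sub>1 \<otimes> \<dots> \<otimes> e\<^sub>J\<^sub>d\<close> to
  \<open>g\<^sub>1 e\<^sub>J\<^sub>1 \<otimes> \<dots> \<otimes> g\<^sub>d e\<^sub>J\<^sub>d\<close>, and acts on the exterior algebra by the induced algebra
  endomorphism.
\<close>

definition act :: "nat \<Rightarrow> nat \<Rightarrow> complex mat list \<Rightarrow> nat list ext \<Rightarrow> nat list ext" where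
  "act d n gs = ext_map (tensor_index d n)
     (\<lambda>J. pure_tensor d n (map2 (\<lambda>g i. g *\<^sub>v unit_vec n i) gs J))"

definition unitriangular :: "nat \<Rightarrow> complex mat set" where
  "unitriangular n = {g \<in> carrier_mat n n. upper_triangular g \<and> (\<forall>i<n. g $$ (i, i) = 1)}"

text \<open>
  A diagonal matrix is invertible iff its diagonal entries are nonzero. Entries of a weight may be
  negative, whence the integer exponents.
\<close>

definition is_weight_vector :: "nat \<Rightarrow> nat \<Rightarrow> int vec list \<Rightarrow> nat list ext \<Rightarrow> bool" where
  "is_weight_vector d n \<mu> v \<longleftrightarrow>
     (\<forall>a :: nat \<Rightarrow> nat \<Rightarrow> complex. (\<forall>j<d. \<forall>i<n. a j i \<noteq> 0) \<longrightarrow>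
        act d n (map (\<lambda>j. mat_diag n (a j)) [0..<d]) v =
          (\<lambda>S. (\<Prod>j<d. \<Prod>i<n. a j i powi ((\<mu> ! j) $ i)) * v S))"

definition is_unitriangular_invariant :: "nat \<Rightarrow> nat \<Rightarrow> nat list ext \<Rightarrow> bool" where
  "is_unitriangular_invariant d n v \<longleftrightarrow>
     (\<forall>gs. length gs = d \<and> set gs \<subseteq> unitriangular n \<longrightarrow> act d n gs v = v)"

text \<open>The zero vector satisfies both conditions, for every \<open>\<mu>\<close>.\<close>

definition HWV :: "nat \<Rightarrow> nat \<Rightarrow> int vec list \<Rightarrow> nat list ext set" where
  "HWV d n \<mu> = {v \<in> ext_tensor d n. is_weight_vector d n \<mu> v \<and> is_unitriangular_invariant d n v}"


section \<open>The Cayley form\<close>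

text \<open>The term of the Cayley form, without its sign, for a tuple of permutations of \<open>{..<n}\<close>.\<close>

definition cayley_term :: "nat \<Rightarrow> nat \<Rightarrow> (nat \<Rightarrow> nat) list \<Rightarrow> nat list ext" where
  "cayley_term d n \<pi>s = wedge_list
     (map (\<lambda>i. ext_vector (pure_tensor d n (map (\<lambda>\<pi>. unit_vec n (\<pi> i)) \<pi>s))) [0..<n])"

definition cayley_form :: "nat \<Rightarrow> nat \<Rightarrow> nat list ext" where
  "cayley_form d n = (\<lambda>R. \<Sum>\<pi>s\<in>{\<pi>s. length \<pi>s = d \<and> set \<pi>s \<subseteq> {\<pi>. \<pi> permutes {..<n}}}.
     of_int (sign (foldr (\<circ>) \<pi>s id)) * cayley_term d n \<pi>s R)"

definition cayley_map :: "nat \<Rightarrow> nat \<Rightarrow> nat list ext \<Rightarrow> nat list ext" where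
  "cayley_map d n v = wedge (cayley_form d n) v"


section \<open>Partitions\<close>

definition is_partition :: "nat list \<Rightarrow> bool" where
  "is_partition p \<longleftrightarrow> sorted_wrt (\<ge>) p \<and> 0 \<notin> set p"

text \<open>The parts of the conjugate are the column lengths; a nonempty partition has \<open>hd p\<close> columns.\<close>

definition conjugate_partition :: "nat list \<Rightarrow> nat list" where
  "conjugate_partition p = map (\<lambda>i. length (filter (\<lambda>x. i < x) p)) [0..<(if p = [] then 0 else hd p)]"

definition add_row :: "nat \<Rightarrow> nat list \<Rightarrow> nat list" where
  "add_row n p = n # p"

definition in_rectangle :: "nat list \<Rightarrow> nat \<Rightarrow> nat \<Rightarrow> bool" where
  "in_rectangle p r c \<longleftrightarrow> length p \<le> r \<and> (\<forall>x\<in>set p. x \<le> c)"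

definition pad :: "nat \<Rightarrow> nat list \<Rightarrow> int vec" where
  "pad n p = vec n (\<lambda>i. if i < length p then int (p ! i) else 0)"

definition HWV_partition :: "nat \<Rightarrow> nat \<Rightarrow> nat list list \<Rightarrow> nat list ext set" where
  "HWV_partition d n ps = HWV d n (map (pad n) ps)"

end

theory Submission
  imports Defs "Jordan_Normal_Form.Determinant"
begin

text \<open>
  The conjugates of the given partitions have at most \<open>k\<close> parts, so a vector of this weight
  in the exterior algebra of \<open>V\<^sub>l\<close>, \<open>l > k\<close>, already lies in the exterior algebra of \<open>V\<^sub>k\<close>, and it is a highest
  weight vector there. Let \<open>D\<close> consist of the diagonal basis tensors \<open>e\<^sub>i \<otimes> \<dots> \<otimes> e\<^sub>i\<close> with
  \<open>k \<le> i < l\<close>. For \<open>v\<close> in the exterior algebra of \<open>V\<^sub>k\<close>, the coefficient of \<open>\<omega>\<^sub>d\<^sub>,\<^sub>l \<and> v\<close> at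
  \<open>R \<union> D\<close> only receives contributions from the coefficients of \<open>\<omega>\<^sub>d\<^sub>,\<^sub>l\<close> at sets \<open>S \<union> D\<close>, and
  those are \<open>l! / k!\<close> times the coefficients of \<open>\<omega>\<^sub>d\<^sub>,\<^sub>k\<close> at \<open>S\<close>. Hence \<open>\<omega>\<^sub>d\<^sub>,\<^sub>l \<and> v\<close> determines
  \<open>\<omega>\<^sub>d\<^sub>,\<^sub>k \<and> v\<close>. That the Cayley maps shift weights as claimed follows from the
  multiplicativity of the group action on the exterior algebra, under which
  \<open>\<omega>\<^sub>d\<^sub>,\<^sub>n\<close> is multiplied by the product of the determinants.
\<close>

section \<open>Exterior algebras and their induced endomorphisms\<close>

definition inversions :: "'a::linorder set \<Rightarrow> 'a set \<Rightarrow> nat" where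
  "inversions S T = card {(s, t). s \<in> S \<and> t \<in> T \<and> t < s}"

lemma inversions_Un_left:
  assumes "finite A" "finite B" "finite C" "A \<inter> B = {}"
  shows "inversions (A \<union> B) C = inversions A C + inversions B C"
proof -
  have fin: "finite {(s, t). s \<in> X \<and> t \<in> C \<and> t < s}" if "finite X" for X :: "'a set"
    by (rule finite_subset[of _ "X \<times> C"]) (use that assms in auto)
  have "{(s, t). s \<in> A \<union> B \<and> t \<in> C \<and> t < s} =
      {(s, t). s \<in> A \<and> t \<in> C \<and> t < s} \<union> {(s, t). s \<in> B \<and> t \<in> C \<and> t < s}" by auto
  then show ?thesis unfolding inversions_def
    using assms by (simp only: ) (rule card_Un_disjoint, auto intro: fin)
qed

lemma inversions_Un_right:
  assumes "finite A" "finite B" "finite C" "A \<inter> B = {}"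
  shows "inversions C (A \<union> B) = inversions C A + inversions C B"
proof -
  have fin: "finite {(s, t). s \<in> C \<and> t \<in> X \<and> t < s}" if "finite X" for X :: "'a set"
    by (rule finite_subset[of _ "C \<times> X"]) (use that assms in auto)
  have "{(s, t). s \<in> C \<and> t \<in> A \<union> B \<and> t < s} =
      {(s, t). s \<in> C \<and> t \<in> A \<and> t < s} \<union> {(s, t). s \<in> C \<and> t \<in> B \<and> t < s}" by auto
  then show ?thesis unfolding inversions_def
    using assms by (simp only: ) (rule card_Un_disjoint, auto intro: fin)
qed

lemma inversions_singleton_left: "inversions {s} T = card {t \<in> T. t < s}"
proof -
  have "{(s', t). s' \<in> {s} \<and> t \<in> T \<and> t < s'} = Pair s ` {t \<in> T. t < s}" by auto
  then show ?thesis unfolding inversions_def by (simp add: card_image inj_on_def)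
qed

lemma wedge_inversions:
  "wedge v w R = (\<Sum>S\<in>Pow R. (-1) ^ inversions S (R - S) * v S * w (R - S))"
  by (simp add: wedge_def inversions_def)

lemma wedge_infinite: "infinite R \<Longrightarrow> wedge v w R = 0"
  by (simp add: wedge_def)

lemma wedge_in_ext_algebra:
  assumes "v \<in> ext_algebra I" "w \<in> ext_algebra I"
  shows "wedge v w \<in> ext_algebra I"
  unfolding ext_algebra_def
proof (intro CollectI allI impI)
  fix R assume R: "\<not> R \<subseteq> I"
  show "wedge v w R = 0" unfolding wedge_inversions
  proof (rule sum.neutral, rule ballI)
    fix S assume "S \<in> Pow R"
    with R have "\<not> S \<subseteq> I \<or> \<not> R - S \<subseteq> I" by blast
    then show "(-1) ^ inversions S (R - S) * v S * w (R - S) = 0"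
      using assms unfolding ext_algebra_def
          by (metis (mono_tags, lifting) mem_Collect_eq mult_eq_0_iff)
  qed
qed

text \<open>Both sides run over the ordered splittings of \<open>R\<close> into three blocks, and on
  both sides the sign counts the inversions between every pair of blocks. At infinite
  \<open>R\<close> all products vanish.\<close>

lemma wedge_assoc: "wedge (wedge u v) w = wedge u (wedge v w)"
proof
  fix R :: "'a set"
  show "wedge (wedge u v) w R = wedge u (wedge v w) R"
  proof (cases "finite R")
    case True
    have fin: "finite S" if "S \<subseteq> R" for S using that True finite_subset by blast
    have "wedge (wedge u v) w R = (\<Sum>S\<in>Pow R. \<Sum>A\<in>Pow S. (-1) ^ inversions S (R - S) *
        ((-1) ^ inversions A (S - A) * u A * v (S - A)) * w (R - S))"
      by (simp add: wedge_inversions sum_distrib_left sum_distrib_right)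
    also have "\<dots> = (\<Sum>(S, A)\<in>Sigma (Pow R) Pow. (-1) ^ inversions S (R - S) *
        ((-1) ^ inversions A (S - A) * u A * v (S - A)) * w (R - S))"
      by (subst sum.Sigma) (use True fin in auto)
    also have "\<dots> = (\<Sum>(A, B)\<in>Sigma (Pow R) (\<lambda>A. Pow (R - A)). (-1) ^ inversions A (R - A) * u A *
        ((-1) ^ inversions B (R - A - B) * v B * w (R - A - B)))"
    \<comment> \<open>A chain \<open>A \<subseteq> S \<subseteq> R\<close> is recorded by its first
      two blocks \<open>A\<close> and \<open>S - A\<close>. The fifth goal compares the summands and
      carries the sign computation.\<close>
    proof (rule sum.reindex_bij_witness[where j = "\<lambda>(S, A). (A, S - A)"
        and i = "\<lambda>(A, B). (A \<union> B, A)"],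
        goal_cases)
      case (5 p)
      then obtain S A where p: "p = (S, A)" "S \<subseteq> R" "A \<subseteq> S" by auto
      have e: "R - A - (S - A) = R - S" "R - A = (S - A) \<union> (R - S)" "S = A \<union> (S - A)"
        using p by auto
      have "inversions S (R - S) + inversions A (S - A) =
          inversions A (R - S) + inversions (S - A) (R - S) + inversions A (S - A)"
        by (subst e(3), subst inversions_Un_left) (use p fin True in auto)
      also have "\<dots> = inversions A (R - A) + inversions (S - A) (R - S)"
        by (subst e(2), subst inversions_Un_right)
          (use p fin True in \<open>auto intro: finite_subset[OF _ True]\<close>)
      finally have "(-1::complex) ^ inversions S (R - S) * (-1) ^ inversions A (S - A) =
         (-1) ^ inversions A (R - A) * (-1) ^ inversions (S - A) (R - S)"
        by (simp flip: power_add)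
      then show ?case by (simp add: p e(1) algebra_simps)
    qed auto
    also have "\<dots> = (\<Sum>A\<in>Pow R. \<Sum>B\<in>Pow (R - A). (-1) ^ inversions A (R - A) * u A *
        ((-1) ^ inversions B (R - A - B) * v B * w (R - A - B)))"
      by (subst sum.Sigma) (use True fin in auto)
    also have "\<dots> = wedge u (wedge v w) R"
      by (simp add: wedge_inversions sum_distrib_left)
    finally show ?thesis .
  qed (simp add: wedge_infinite)
qed

lemma wedge_scale_left: "wedge (\<lambda>S. c * v S) w = (\<lambda>R. c * wedge v w R)"
  by (rule ext) (simp add: wedge_def sum_distrib_left algebra_simps)

lemma wedge_scale_right: "wedge v (\<lambda>S. c * w S) = (\<lambda>R. c * wedge v w R)"
  by (rule ext) (simp add: wedge_def sum_distrib_left algebra_simps)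

lemma wedge_sum_left: "wedge (\<lambda>S. \<Sum>i\<in>A. v i S) w = (\<lambda>R. \<Sum>i\<in>A. wedge (v i) w R)"
  by (rule ext) (simp add: wedge_def sum_distrib_left sum_distrib_right sum.swap[of _ A])

lemma wedge_sum_right: "wedge v (\<lambda>S. \<Sum>i\<in>A. w i S) = (\<lambda>R. \<Sum>i\<in>A. wedge v (w i) R)"
  by (rule ext) (simp add: wedge_def sum_distrib_left sum_distrib_right sum.swap[of _ A])

lemma wedge_zero_right: "wedge v (\<lambda>_. 0) = (\<lambda>_. 0)"
  by (rule ext) (simp add: wedge_def)

section \<open>Products with a single vector\<close>

text \<open>Only singletons \<open>S = {r}\<close> contribute, with one sign for each element of
  \<open>R\<close> below \<open>r\<close>. This expansion later becomes the Laplace expansion along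
  a first row.\<close>

lemma wedge_ext_vector:
  assumes "finite R"
  shows "wedge (ext_vector x) w R = (\<Sum>r\<in>R. (-1) ^ card {t \<in> R. t < r} * x r * w (R - {r}))"
proof -
  have "wedge (ext_vector x) w R =
      (\<Sum>S\<in>(\<lambda>r. {r}) ` R. (-1) ^ inversions S (R - S) * ext_vector x S * w (R - S))"
    unfolding wedge_inversions
    by (rule sum.mono_neutral_right) (use assms in \<open>auto simp: ext_vector_def is_singleton_def\<close>)
  also have "\<dots> = (\<Sum>r\<in>R. (-1) ^ inversions {r} (R - {r}) * x r * w (R - {r}))"
    by (subst sum.reindex) (auto simp: inj_on_def ext_vector_def)
  also have "\<dots> = (\<Sum>r\<in>R. (-1) ^ card {t \<in> R. t < r} * x r * w (R - {r}))"
  proof (intro sum.cong refl)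
    fix r
    have "{t \<in> R - {r}. t < r} = {t \<in> R. t < r}" by auto
    then show "(-1) ^ inversions {r} (R - {r}) * x r * w (R - {r}) =
        (-1) ^ card {t \<in> R. t < r} * x r * w (R - {r})"
      by (simp only: inversions_singleton_left)
  qed
  finally show ?thesis .
qed

lemma wedge_ext_one_left:
  assumes "finite R" shows "wedge ext_one w R = w R"
proof -
  have "wedge ext_one w R = (\<Sum>S\<in>{{}}. (-1) ^ inversions S (R - S) * ext_one S * w (R - S))"
    unfolding wedge_inversions
    by (rule sum.mono_neutral_right) (use assms in \<open>auto simp: ext_one_def\<close>)
  then show ?thesis by (simp add: ext_one_def inversions_def)
qed

text \<open>The product is supported on two-element sets \<open>{a, b}\<close> with
  \<open>a < b\<close>, where its coefficient is the 2x2 minor of the two vectors; exchanging the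
  vectors negates this minor.\<close>

lemma wedge_ext_vector_anticomm:
  "wedge (ext_vector x) (ext_vector y) = (\<lambda>R. - wedge (ext_vector y) (ext_vector x) R)"
proof
  fix R :: "'a set"
  show "wedge (ext_vector x) (ext_vector y) R = - wedge (ext_vector y) (ext_vector x) R"
  proof (cases "card R = 2")
    case True
    then obtain a b where R: "R = {a, b}" and ab: "a < b"
      by (metis card_2_iff insert_commute linorder_less_linear)
    have lt: "{t \<in> {a, b}. t < a} = {}" "{t \<in> {a, b}. t < b} = {a}"
      using ab by auto
    have d: "{a, b} - {a} = {b}" "{a, b} - {b} = {a}" using ab by auto
    have "wedge (ext_vector p) (ext_vector q) R = p a * q b - p b * q a" for p q :: "'a \<Rightarrow> complex"
    proof -
      have "wedge (ext_vector p) (ext_vector q) R =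
          (\<Sum>r\<in>{a, b}. (-1) ^ card {t \<in> {a, b}. t < r} * p r * ext_vector q ({a, b} - {r}))"
        unfolding R by (rule wedge_ext_vector) simp
      also have "\<dots> = (-1) ^ card {t \<in> {a, b}. t < a} * p a * ext_vector q ({a, b} - {a}) +
          (-1) ^ card {t \<in> {a, b}. t < b} * p b * ext_vector q ({a, b} - {b})"
        using ab by (subst sum.insert) auto
      also have "\<dots> = p a * q b - p b * q a"
        unfolding lt d by (simp add: ext_vector_def)
      finally show ?thesis .
    qed
    then show ?thesis by simp
  next
    case False
    have z: "wedge (ext_vector p) (ext_vector q) R = 0" for p q :: "'a \<Rightarrow> complex"
    proof (cases "finite R")
      case True
      have "\<not> is_singleton (R - {r})" if "r \<in> R" for r
        using that False True by (auto simp: is_singleton_altdef card_Diff_singleton)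
      then show ?thesis using True by (simp add: wedge_ext_vector ext_vector_def[of q])
    qed (simp add: wedge_infinite)
    show ?thesis by (simp add: z)
  qed
qed

lemma wedge_ext_vector_swap:
  "wedge (ext_vector x) (wedge (ext_vector y) w) =
    (\<lambda>R. - wedge (ext_vector y) (wedge (ext_vector x) w) R)"
proof -
  have "wedge (ext_vector x) (wedge (ext_vector y) w) =
      wedge (\<lambda>R. (-1) * wedge (ext_vector y) (ext_vector x) R) w"
    by (simp add: wedge_ext_vector_anticomm[of x y] flip: wedge_assoc)
  also have "\<dots> = (\<lambda>R. - wedge (ext_vector y) (wedge (ext_vector x) w) R)"
    by (subst wedge_scale_left) (simp add: wedge_assoc)
  finally show ?thesis .
qed

lemma wedge_ext_vector_self: "wedge (ext_vector x) (wedge (ext_vector x) w) = (\<lambda>_. 0)"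
proof
  fix R
  have "wedge (ext_vector x) (wedge (ext_vector x) w) R =
      - wedge (ext_vector x) (wedge (ext_vector x) w) R"
    by (subst wedge_ext_vector_swap) simp
  then show "wedge (ext_vector x) (wedge (ext_vector x) w) R = 0" by simp
qed

lemma wedge_list_Nil: "wedge_list [] = ext_one"
  by (simp add: wedge_list_def)

lemma wedge_list_Cons: "wedge_list (v # vs) = wedge v (wedge_list vs)"
  by (simp add: wedge_list_def)

lemma wedge_list_infinite: "infinite R \<Longrightarrow> wedge_list vs R = 0"
  by (cases vs) (auto simp: wedge_list_Nil wedge_list_Cons ext_one_def wedge_infinite)

lemma wedge_list_in_ext_algebra:
  "set vs \<subseteq> ext_algebra I \<Longrightarrow> wedge_list vs \<in> ext_algebra I"
  by (induction vs) (auto simp: wedge_list_Nil wedge_list_Cons wedge_in_ext_algebra,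
      auto simp: ext_algebra_def ext_one_def)

section \<open>Images of basis products and multiplicativity of \<open>ext_map\<close>\<close>

text \<open>The image of \<open>b\<^sub>S\<close> under the induced endomorphism, split off from
  \<open>ext_map\<close> so that it can be studied by induction on \<open>S\<close>.\<close>

definition basis_image :: "('a::linorder \<Rightarrow> 'a \<Rightarrow> complex) \<Rightarrow> 'a set \<Rightarrow> 'a ext" where
  "basis_image f S = wedge_list (map (\<lambda>i. ext_vector (f i)) (sorted_list_of_set S))"

lemma ext_map_basis_image: "ext_map I f v = (\<lambda>R. \<Sum>S\<in>Pow I. v S * basis_image f S R)"
  by (simp add: ext_map_def basis_image_def)

lemma basis_image_empty: "basis_image f {} = ext_one"
  by (simp add: basis_image_def wedge_list_Nil)

lemma basis_image_insert_less:
  assumes "finite S" "\<forall>s\<in>S. a < s"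
  shows "basis_image f (insert a S) = wedge (ext_vector (f a)) (basis_image f S)"
proof -
  have "a \<notin> S" using assms by auto
  then have "sorted_list_of_set (insert a S) = insort a (sorted_list_of_set S)"
    using assms by simp
  also have "\<dots> = a # sorted_list_of_set S"
    using assms by (intro insort_is_Cons) (auto intro: less_imp_le)
  finally show ?thesis by (simp add: basis_image_def wedge_list_Cons)
qed

text \<open>The new factor is moved to its sorted position, one sign for each smaller index passed;
  if \<open>a\<close> already occurs, it meets its own copy and the product vanishes. The induction
  adds a new minimum \<open>b\<close>, which is the outermost factor.\<close>

lemma wedge_basis_image_insert:
  assumes "finite S"
  shows "wedge (ext_vector (f a)) (basis_image f S) =
    (\<lambda>R. if a \<in> S then 0 else (-1) ^ card {s \<in> S. s < a} * basis_image f (insert a S) R)"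
  using assms
proof (induction S rule: finite_linorder_min_induct)
  case empty
  then show ?case using basis_image_insert_less[of "{}" a f] by simp
next
  case (insert b S)
  consider "a = b" | "a < b" | "b < a" by (meson linorder_less_linear)
  then show ?case
  proof cases
    case 1
    then show ?thesis using insert.hyps by (simp add: basis_image_insert_less wedge_ext_vector_self)
  next
    case 2
    then have lt: "\<forall>s\<in>insert b S. a < s" using insert by auto
    then have e: "{s \<in> insert b S. s < a} = {}" by auto
    have "a \<notin> insert b S" using lt by auto
    then show ?thesis unfolding e
      using lt insert.hyps(1) by (simp add: basis_image_insert_less[of "insert b S" a])
  next
    \<comment> \<open>Passing the outermost factor \<open>b\<close> costs one sign, which is the
      additional element counted in \<open>c\<close>.\<close>
    case 3
    have bi: "b \<notin> S" using insert by auto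
    have c: "card {s \<in> insert b S. s < a} = Suc (card {s \<in> S. s < a})"
    proof -
      have "{s \<in> insert b S. s < a} = insert b {s \<in> S. s < a}" using 3 by auto
      then show ?thesis using bi insert by simp
    qed
    have "wedge (ext_vector (f a)) (basis_image f (insert b S)) =
        (\<lambda>R. - wedge (ext_vector (f b)) (wedge (ext_vector (f a)) (basis_image f S)) R)"
      using insert by (simp add: basis_image_insert_less wedge_ext_vector_swap[of "f a"])
    also have "\<dots> = (\<lambda>R. if a \<in> insert b S then 0
        else (-1) ^ card {s \<in> insert b S. s < a} * basis_image f (insert a (insert b S)) R)"
    proof (cases "a \<in> S")
      case True
      then show ?thesis by (simp add: insert.IH wedge_zero_right)
    next
      case False
      have "basis_image f (insert a (insert b S)) =
          wedge (ext_vector (f b)) (basis_image f (insert a S))"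
        using insert 3 basis_image_insert_less[of "insert a S" b f] by (simp add: insert_commute)
      moreover have "a \<noteq> b" using 3 by auto
      ultimately show ?thesis unfolding c using False by (simp add: insert.IH wedge_scale_right)
    qed
    finally show ?thesis .
  qed
qed

text \<open>Images of basis products multiply by the same sign rule as the basis products
  themselves, since the factors of \<open>S\<close> can be inserted into \<open>T\<close> one by
  one, the largest first.\<close>

lemma wedge_basis_image:
  assumes "finite S" "finite T"
  shows "wedge (basis_image f S) (basis_image f T) =
    (\<lambda>R. if S \<inter> T = {} then (-1) ^ inversions S T * basis_image f (S \<union> T) R else 0)"
  using assms
proof (induction S rule: finite_linorder_min_induct)
  case empty
  have "wedge ext_one (basis_image f T) R = basis_image f T R" for R
    by (cases "finite R")
      (auto simp: wedge_ext_one_left wedge_infinite basis_image_def wedge_list_infinite)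
  then show ?case by (auto simp: basis_image_empty inversions_def)
next
  case (insert b S)
  have fin: "finite T" "finite S" using insert by auto
  have bS: "b \<notin> S" using insert by auto
  have "wedge (basis_image f (insert b S)) (basis_image f T) =
      wedge (ext_vector (f b)) (wedge (basis_image f S) (basis_image f T))"
    using insert by (simp add: basis_image_insert_less wedge_assoc)
  also have "\<dots> = (\<lambda>R. if insert b S \<inter> T = {} then
      (-1) ^ inversions (insert b S) T * basis_image f (insert b S \<union> T) R else 0)"
  proof (cases "S \<inter> T = {}")
    case False
    then show ?thesis using insert by (auto simp: wedge_zero_right)
  next
    case True
    \<comment> \<open>The minimum \<open>b\<close> only has to pass elements of \<open>T\<close>,
      because nothing in \<open>S\<close> lies below it.\<close>
    have e: "{s \<in> S \<union> T. s < b} = {t \<in> T. t < b}" using insert by auto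
    have "inversions (insert b S) T = card {t \<in> T. t < b} + inversions S T"
      using inversions_Un_left[of "{b}" S T] fin bS by (simp add: inversions_singleton_left)
    moreover have "b \<in> S \<union> T \<longleftrightarrow> insert b S \<inter> T \<noteq> {}" using True bS by auto
    moreover have "wedge (ext_vector (f b)) (wedge (basis_image f S) (basis_image f T)) =
        (\<lambda>R. (-1) ^ inversions S T * (if b \<in> S \<union> T then 0
          else (-1) ^ card {t \<in> T. t < b} * basis_image f (insert b (S \<union> T)) R))"
      using True fin wedge_basis_image_insert[of "S \<union> T" f b] unfolding e
      by (simp add: insert.IH wedge_scale_right)
    ultimately show ?thesis by (auto simp: power_add)
  qed
  finally show ?case .
qed

text \<open>By bilinearity the claim reduces to products of basis elements, which
  \<open>wedge_basis_image\<close> settles. The sum over \<open>Q\<close> and a subset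
  \<open>S\<close> is rewritten over disjoint pairs \<open>S\<close>, \<open>T\<close> with union
  \<open>Q\<close>.\<close>

lemma ext_map_wedge:
  assumes I: "finite I"
  shows "ext_map I f (wedge v w) = wedge (ext_map I f v) (ext_map I f w)"
proof
  fix R
  have fin: "finite S" if "S \<subseteq> I" for S using that I finite_subset by blast
  have "ext_map I f (wedge v w) R = (\<Sum>Q\<in>Pow I. \<Sum>S\<in>Pow Q.
      (-1) ^ inversions S (Q - S) * v S * w (Q - S) * basis_image f Q R)"
    by (simp add: ext_map_basis_image wedge_inversions sum_distrib_right)
  also have "\<dots> = (\<Sum>(Q, S)\<in>Sigma (Pow I) Pow.
      (-1) ^ inversions S (Q - S) * v S * w (Q - S) * basis_image f Q R)"
    by (subst sum.Sigma) (use I fin in auto)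
  also have "\<dots> = (\<Sum>(S, T)\<in>Sigma (Pow I) (\<lambda>S. {T\<in>Pow I. S \<inter> T = {}}).
      v S * w T * wedge (basis_image f S) (basis_image f T) R)"
    by (rule sum.reindex_bij_witness[where j = "\<lambda>(Q, S). (S, Q - S)" and i = "\<lambda>(S, T). (S \<union> T, S)"])
      (auto simp: wedge_basis_image fin Un_absorb1)
  \<comment> \<open>Intersecting pairs may be added, since their basis images multiply to
    zero.\<close>
  also have "\<dots> = (\<Sum>(S, T)\<in>Pow I \<times> Pow I. v S * w T * wedge (basis_image f S) (basis_image f T) R)"
    by (rule sum.mono_neutral_left) (auto simp: wedge_basis_image fin I split: if_splits)
  also have "\<dots> = wedge (ext_map I f v) (ext_map I f w) R"
    unfolding ext_map_basis_image wedge_sum_left wedge_sum_right wedge_scale_left wedge_scale_right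
    by (subst sum.cartesian_product[symmetric]) (simp add: sum_distrib_left mult.assoc)
  finally show "ext_map I f (wedge v w) R = wedge (ext_map I f v) (ext_map I f w) R" .
qed

lemma wedge_ext_vector_ext_one: "wedge (ext_vector x) ext_one = ext_vector x"
proof
  fix R :: "'a set"
  show "wedge (ext_vector x) ext_one R = ext_vector x R"
  proof (cases "finite R")
    case True
    have "wedge (ext_vector x) ext_one R = (\<Sum>S\<in>{R}. (-1) ^ inversions S (R - S) * ext_vector x S *
        ext_one (R - S))"
      unfolding wedge_inversions
      by (rule sum.mono_neutral_right) (use True in \<open>auto simp: ext_one_def\<close>)
    then show ?thesis by (simp add: ext_one_def inversions_def)
  next
    case False
    then have "\<not> is_singleton R" by (auto simp: is_singleton_def)
    then show ?thesis using False by (simp add: wedge_infinite ext_vector_def)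
  qed
qed

lemma ext_map_ext_one:
  assumes "finite I" shows "ext_map I f ext_one = ext_one"
proof
  fix R
  have "ext_map I f ext_one R = (\<Sum>S\<in>{{}}. ext_one S * basis_image f S R)"
    unfolding ext_map_basis_image
    by (rule sum.mono_neutral_right) (use assms in \<open>auto simp: ext_one_def\<close>)
  then show "ext_map I f ext_one R = ext_one R" by (simp add: basis_image_empty ext_one_def)
qed

lemma basis_image_singleton: "basis_image f {i} = ext_vector (f i)"
  using basis_image_insert_less[of "{}" i f]
      by (simp add: basis_image_empty wedge_ext_vector_ext_one)

lemma ext_map_ext_vector:
  assumes "finite I"
  shows "ext_map I f (ext_vector x) = ext_vector (\<lambda>j. \<Sum>i\<in>I. x i * f i j)"
proof
  fix R
  have "ext_map I f (ext_vector x) R = (\<Sum>S\<in>(\<lambda>i. {i}) ` I. ext_vector x S * basis_image f S R)"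
    unfolding ext_map_basis_image
    by (rule sum.mono_neutral_right) (use assms in \<open>auto simp: ext_vector_def is_singleton_def\<close>)
  also have "\<dots> = (\<Sum>i\<in>I. x i * ext_vector (f i) R)"
    by (subst sum.reindex) (auto simp: inj_on_def ext_vector_def[of x] basis_image_singleton)
  also have "\<dots> = ext_vector (\<lambda>j. \<Sum>i\<in>I. x i * f i j) R"
    by (simp add: ext_vector_def)
  finally show "ext_map I f (ext_vector x) R = ext_vector (\<lambda>j. \<Sum>i\<in>I. x i * f i j) R" .
qed

lemma ext_map_wedge_list:
  assumes "finite I" shows "ext_map I f (wedge_list vs) = wedge_list (map (ext_map I f) vs)"
  by (induction vs)
    (auto simp: wedge_list_Nil wedge_list_Cons ext_map_ext_one ext_map_wedge assms)

lemma ext_map_sum: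
  "ext_map I f (\<lambda>S. \<Sum>i\<in>A. c i * v i S) = (\<lambda>R. \<Sum>i\<in>A. c i * ext_map I f (v i) R)"
  by (rule ext)
    (simp add: ext_map_def sum_distrib_left sum_distrib_right sum.swap[of _ A] mult.assoc)

lemma ext_map_cong:
  assumes "finite I" "\<And>i. i \<in> I \<Longrightarrow> f i = g i"
  shows "ext_map I f v = ext_map I g v"
proof
  fix R
  have "basis_image f S = basis_image g S" if "S \<subseteq> I" for S
  proof -
    have "finite S" using that assms finite_subset by blast
    then show ?thesis unfolding basis_image_def using that assms
      by (intro arg_cong[where f=wedge_list] map_cong) auto
  qed
  then show "ext_map I f v R = ext_map I g v R"
    unfolding ext_map_basis_image by (intro sum.cong) auto
qed

section \<open>Diagonal endomorphisms\<close>

text \<open>No sign appears: each induction step adds a new minimum \<open>b\<close>, so the only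
  surviving term of the expansion has no index below \<open>b\<close>.\<close>

lemma basis_image_diagonal:
  assumes "finite S"
  shows "basis_image (\<lambda>i j. if j = i then c i else 0) S R = (if R = S then \<Prod>i\<in>S. c i else 0)"
  using assms
proof (induction S arbitrary: R rule: finite_linorder_min_induct)
  case empty
  then show ?case by (simp add: basis_image_empty ext_one_def)
next
  case (insert b S)
  let ?f = "\<lambda>i j. if j = i then c i else 0"
  have bS: "b \<notin> S" using insert by auto
  have *: "basis_image ?f (insert b S) R = wedge (ext_vector (?f b)) (basis_image ?f S) R"
    using insert by (simp add: basis_image_insert_less)
  show ?case
  proof (cases "finite R \<and> b \<in> R")
    case False
    then have "R \<noteq> insert b S" using insert by auto
    moreover have "wedge (ext_vector (?f b)) (basis_image ?f S) R = 0"
    proof (cases "finite R")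
      case True
      then show ?thesis unfolding wedge_ext_vector[OF True] by (intro sum.neutral)
          (use False in auto)
    qed (simp add: wedge_infinite)
    ultimately show ?thesis using * by simp
  next
    case True
    then have fin: "finite R" and bR: "b \<in> R" by auto
    have "wedge (ext_vector (?f b)) (basis_image ?f S) R =
        (\<Sum>r\<in>{b}. (-1) ^ card {t \<in> R. t < r} * ?f b r * basis_image ?f S (R - {r}))"
      unfolding wedge_ext_vector[OF fin]
      by (rule sum.mono_neutral_right) (use fin bR in auto)
    also have "\<dots> = (-1) ^ card {t \<in> R. t < b} * c b * (if R - {b} = S then \<Prod>i\<in>S. c i else 0)"
      by (simp add: insert.IH)
    also have "\<dots> = (if R = insert b S then \<Prod>i\<in>insert b S. c i else 0)"
    proof (cases "R = insert b S")
      case True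
      then have e: "{t \<in> R. t < b} = {}" and "R - {b} = S" using insert.hyps bS by auto
      then show ?thesis unfolding e using True bS insert.hyps(1) by simp
    next
      case False
      then show ?thesis using bR by auto
    qed
    finally show ?thesis using * by simp
  qed
qed

lemma ext_map_diagonal:
  assumes "finite I"
  shows "ext_map I (\<lambda>i j. if j = i then c i else 0) v R = (if R \<subseteq> I then (\<Prod>i\<in>R. c i) * v R else 0)"
proof -
  have "ext_map I (\<lambda>i j. if j = i then c i else 0) v R =
      (\<Sum>S\<in>Pow I. if R = S then (\<Prod>i\<in>S. c i) * v S else 0)"
    unfolding ext_map_basis_image
  proof (intro sum.cong refl)
    fix S assume "S \<in> Pow I"
    then have "finite S" using assms finite_subset by blast
    then show "v S * basis_image (\<lambda>i j. if j = i then c i else 0) S R =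
        (if R = S then (\<Prod>i\<in>S. c i) * v S else 0)"
      by (simp add: basis_image_diagonal)
  qed
  then show ?thesis using assms by simp
qed

section \<open>Coefficients of products of vectors as minors\<close>

text \<open>These are the two ingredients of a Laplace expansion whose columns are indexed by
  \<open>R\<close> in increasing order: the columns left after deleting the \<open>j\<close>-th one,
  and the elements that determine its sign.\<close>

lemma sorted_list_of_set_Diff_nth:
  assumes "finite R" "j < card R"
  shows "sorted_list_of_set (R - {sorted_list_of_set R ! j}) =
      take j (sorted_list_of_set R) @ drop (Suc j) (sorted_list_of_set R)"
    and "{t \<in> R. t < sorted_list_of_set R ! j} = set (take j (sorted_list_of_set R))"
proof -
  define rs where "rs = sorted_list_of_set R"
  have rs: "rs = take j rs @ rs ! j # drop (Suc j) rs"
    using assms by (intro id_take_nth_drop) (simp add: rs_def)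
  have st: "sorted_wrt (<) (take j rs @ rs ! j # drop (Suc j) rs)"
    using rs by (metis rs_def strict_sorted_list_of_set)
  have set: "R = set (take j rs @ rs ! j # drop (Suc j) rs)"
    using rs by (metis rs_def assms(1) set_sorted_list_of_set)
  have "sorted_wrt (<) (take j rs @ drop (Suc j) rs)"
    using st by (auto simp: sorted_wrt_append)
  moreover have "set (take j rs @ drop (Suc j) rs) = R - {rs ! j}"
    using st unfolding set by (auto simp: sorted_wrt_append)
  ultimately have "sorted_list_of_set (R - {rs ! j}) = take j rs @ drop (Suc j) rs"
    by (metis strict_sorted_equal strict_sorted_list_of_set set_sorted_list_of_set assms(1)
        finite_Diff)
  then show "sorted_list_of_set (R - {sorted_list_of_set R ! j}) =
      take j (sorted_list_of_set R) @ drop (Suc j) (sorted_list_of_set R)"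
    by (simp only: rs_def)
  have "{t \<in> R. t < rs ! j} = set (take j rs)"
    using st unfolding set by (auto simp: sorted_wrt_append)
  then show "{t \<in> R. t < sorted_list_of_set R ! j} = set (take j (sorted_list_of_set R))"
    by (simp only: rs_def)
qed

text \<open>Splitting off the first vector by \<open>wedge_ext_vector\<close> is exactly the Laplace
  expansion of the determinant along row 0.\<close>

lemma wedge_list_det:
  assumes "finite R"
  shows "wedge_list (map ext_vector xs) R = (if card R = length xs
    then det (mat (length xs) (length xs) (\<lambda>(i, j). (xs ! i) (sorted_list_of_set R ! j))) else 0)"
  using assms
proof (induction xs arbitrary: R)
  case Nil
  then show ?case by (simp add: wedge_list_Nil ext_one_def det_def)
next
  case (Cons x xs)
  let ?n = "Suc (length xs)"
  define rs where "rs = sorted_list_of_set R"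
  have "wedge_list (map ext_vector (x # xs)) R =
      (\<Sum>r\<in>R. (-1) ^ card {t \<in> R. t < r} * x r * wedge_list (map ext_vector xs) (R - {r}))"
    using Cons.prems by (simp add: wedge_list_Cons wedge_ext_vector)
  also have "\<dots> = (if card R = ?n
    then det (mat ?n ?n (\<lambda>(i, j). ((x # xs) ! i) (rs ! j))) else 0)"
  proof (cases "card R = ?n")
    case False
    then have "card (R - {r}) \<noteq> length xs" if "r \<in> R" for r
      using that Cons.prems card_Suc_Diff1[of R r] by auto
    then show ?thesis using False Cons.prems by (simp add: Cons.IH)
  next
    case True
    let ?M = "mat ?n ?n (\<lambda>(i, j). ((x # xs) ! i) (rs ! j))"
    have len: "length rs = ?n" and d: "distinct rs" and R: "set rs = R"
      using True Cons.prems by (auto simp: rs_def)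
    have bij: "bij_betw ((!) rs) {..<?n} R"
      using d len R by (intro bij_betw_nth) auto
    have "(\<Sum>r\<in>R. (-1) ^ card {t \<in> R. t < r} * x r * wedge_list (map ext_vector xs) (R - {r})) =
       (\<Sum>j<?n. (-1) ^ card {t \<in> R. t < rs ! j} * x (rs ! j) *
         wedge_list (map ext_vector xs) (R - {rs ! j}))"
      by (rule sum.reindex_bij_betw[OF bij, symmetric])
    also have "\<dots> = (\<Sum>j<?n. ?M $$ (0, j) * cofactor ?M 0 j)"
    proof (intro sum.cong refl)
      fix j assume "j \<in> {..<?n}"
      then have j: "j < ?n" by simp
      have srt: "sorted_list_of_set (R - {rs ! j}) = take j rs @ drop (Suc j) rs"
        using sorted_list_of_set_Diff_nth(1)[OF Cons.prems, of j] j True by (simp add: rs_def)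
      have "{t \<in> R. t < rs ! j} = set (take j rs)"
        using sorted_list_of_set_Diff_nth(2)[OF Cons.prems, of j] j True by (simp add: rs_def)
      \<comment> \<open>Exactly \<open>j\<close> elements of \<open>R\<close> precede
        \<open>rs ! j\<close>, so the sign of the wedge product is that of the cofactor at
        \<open>(0, j)\<close>.\<close>
      then have c: "card {t \<in> R. t < rs ! j} = j"
        using d j len by (simp add: distinct_card)
      have "rs ! j \<in> R" using R j len by auto
      then have "card (R - {rs ! j}) = length xs" using True Cons.prems by simp
      then have "wedge_list (map ext_vector xs) (R - {rs ! j}) =
          det (mat (length xs) (length xs) (\<lambda>(i, j'). (xs ! i) ((take j rs @ drop (Suc j) rs) !
              j')))"
        using Cons.prems by (simp add: Cons.IH srt)
      also have "mat (length xs) (length xs) (\<lambda>(i, j'). (xs ! i) ((take j rs @ drop (Suc j) rs) !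
          j')) =
          mat_delete ?M 0 j"
        using j len by (intro eq_matI) (auto simp: mat_delete_def nth_append)
      finally show "(-1) ^ card {t \<in> R. t < rs ! j} * x (rs ! j) *
          wedge_list (map ext_vector xs) (R - {rs ! j}) =
          ?M $$ (0, j) * cofactor ?M 0 j"
        using j by (simp add: c cofactor_def)
    qed
    also have "\<dots> = det ?M"
      by (rule laplace_expansion_row[symmetric]) auto
    finally show ?thesis using True by simp
  qed
  finally show ?case by (simp add: rs_def)
qed

section \<open>Coefficients of the Cayley form\<close>

text \<open>Distributivity for \<open>d\<close> independent choices. It decouples the
  \<open>d\<close> permutations in the sum that defines the Cayley form.\<close>

lemma sum_lists_prod:
  fixes F :: "nat \<Rightarrow> 'a \<Rightarrow> 'b::comm_semiring_1"
  assumes "finite P"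
  shows "(\<Sum>xs\<in>{xs. length xs = d \<and> set xs \<subseteq> P}. \<Prod>j<d. F j (xs ! j)) = (\<Prod>j<d. \<Sum>x\<in>P. F j x)"
proof (induction d arbitrary: F)
  case 0
  have "{xs::'a list. length xs = 0 \<and> set xs \<subseteq> P} = {[]}" by auto
  then show ?case by simp
next
  case (Suc d)
  let ?L = "{xs. length xs = d \<and> set xs \<subseteq> P}"
  have L: "{xs. length xs = Suc d \<and> set xs \<subseteq> P} = (\<lambda>(x, xs). x # xs) ` (P \<times> ?L)"
  proof (intro equalityI subsetI)
    fix xs assume "xs \<in> {xs. length xs = Suc d \<and> set xs \<subseteq> P}"
    then show "xs \<in> (\<lambda>(x, xs). x # xs) ` (P \<times> ?L)" by (cases xs) auto
  qed auto
  have "(\<Sum>xs\<in>{xs. length xs = Suc d \<and> set xs \<subseteq> P}. \<Prod>j<Suc d. F j (xs ! j)) =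
      (\<Sum>(x, xs)\<in>P \<times> ?L. \<Prod>j<Suc d. F j ((x # xs) ! j))"
    unfolding L by (subst sum.reindex) (auto simp: inj_on_def case_prod_unfold)
  also have "\<dots> = (\<Sum>x\<in>P. \<Sum>xs\<in>?L. F 0 x * (\<Prod>j<d. F (Suc j) (xs ! j)))"
    by (simp add: sum.cartesian_product[symmetric] prod.lessThan_Suc_shift del: prod.lessThan_Suc)
  also have "\<dots> = (\<Sum>x\<in>P. F 0 x) * (\<Prod>j<d. \<Sum>x\<in>P. F (Suc j) x)"
    by (simp add: sum_distrib_left[symmetric] sum_distrib_right[symmetric]
        Suc.IH[of "\<lambda>j. F (Suc j)"])
  finally show ?case by (simp add: prod.lessThan_Suc_shift del: prod.lessThan_Suc)
qed

text \<open>Both claims share one induction, because multiplicativity of \<open>sign\<close>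
  requires the composite of the remaining maps to be a permutation.\<close>

lemma sign_foldr_comp:
  assumes "finite A" "set \<pi>s \<subseteq> {\<pi>. \<pi> permutes A}"
  shows "foldr (\<circ>) \<pi>s id permutes A"
    and "sign (foldr (\<circ>) \<pi>s id) = (\<Prod>j<length \<pi>s. sign (\<pi>s ! j))"
proof -
  have "foldr (\<circ>) \<pi>s id permutes A \<and> sign (foldr (\<circ>) \<pi>s id) = (\<Prod>j<length \<pi>s. sign (\<pi>s ! j))"
    using assms(2)
  proof (induction \<pi>s)
    case Nil
    then show ?case by (simp add: permutes_def)
  next
    case (Cons \<pi> \<pi>s)
    then have \<pi>: "\<pi> permutes A" and \<pi>s: "set \<pi>s \<subseteq> {\<pi>. \<pi> permutes A}" by auto
    note IH = Cons.IH[OF \<pi>s]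
    from conjunct1[OF IH] \<pi> have "foldr (\<circ>) \<pi>s id permutes A" "\<pi> permutes A" .
    moreover from this have "permutation (foldr (\<circ>) \<pi>s id)" "permutation \<pi>"
      using assms(1) permutes_imp_permutation by blast+
    moreover have "foldr (\<circ>) (\<pi> # \<pi>s) id = \<pi> \<circ> foldr (\<circ>) \<pi>s id"
        by (simp only: foldr.simps comp_apply)
    moreover have "sign (foldr (\<circ>) \<pi>s id) = (\<Prod>j<length \<pi>s. sign (\<pi>s ! j))"
      by (rule conjunct2[OF IH])
    ultimately show ?case
      by (simp only: sign_compose permutes_compose length_Cons prod.lessThan_Suc_shift nth_Cons_0
          nth_Cons_Suc simp_thms)
  qed
  then show "foldr (\<circ>) \<pi>s id permutes A"
    and "sign (foldr (\<circ>) \<pi>s id) = (\<Prod>j<length \<pi>s. sign (\<pi>s ! j))" by auto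
qed

lemma finite_tensor_index: "finite (tensor_index d n)"
  unfolding tensor_index_def using finite_lists_length_eq[of "{..<n}" d] by (simp add: conj_commute)

lemma tensor_index_nth: "J \<in> tensor_index d n \<Longrightarrow> j < d \<Longrightarrow> J ! j < n"
  unfolding tensor_index_def by (force dest: nth_mem[of j J])

lemma pure_tensor_image:
  assumes "length gs = d" "set gs \<subseteq> carrier_mat n n" "length \<pi>s = d"
    "set \<pi>s \<subseteq> {\<pi>. \<pi> permutes {..<n}}" "i < n"
  shows "pure_tensor d n (map2 (\<lambda>g \<pi>. g *\<^sub>v unit_vec n (\<pi> i)) gs \<pi>s) K =
    (if K \<in> tensor_index d n then \<Prod>j<d. gs ! j $$ (K ! j, (\<pi>s ! j) i) else 0)"
proof (cases "K \<in> tensor_index d n")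
  case True
  have "(\<Prod>j<d. (map2 (\<lambda>g \<pi>. g *\<^sub>v unit_vec n (\<pi> i)) gs \<pi>s ! j) $ (K ! j)) =
      (\<Prod>j<d. gs ! j $$ (K ! j, (\<pi>s ! j) i))"
  proof (intro prod.cong refl)
    fix j assume "j \<in> {..<d}"
    then have j: "j < d" by simp
    then have "gs ! j \<in> carrier_mat n n" "\<pi>s ! j permutes {..<n}"
      using assms(1,3) subsetD[OF assms(2) nth_mem[of j gs]] subsetD[OF assms(4) nth_mem[of j \<pi>s]]
      by auto
    moreover from this have "(\<pi>s ! j) i < n" using assms(5) permutes_in_image by fastforce
    ultimately show "(map2 (\<lambda>g \<pi>. g *\<^sub>v unit_vec n (\<pi> i)) gs \<pi>s ! j) $ (K ! j) =
        gs ! j $$ (K ! j, (\<pi>s ! j) i)"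
      using j assms(1,3) tensor_index_nth[OF True j] by simp
  qed
  then show ?thesis using True by (simp add: pure_tensor_def)
qed (simp add: pure_tensor_def)

section \<open>The Cayley form under tuples of matrices\<close>

text \<open>The Cayley form with every \<open>e\<^sub>m\<close> in tensor position \<open>j\<close>
  replaced by column \<open>m\<close> of \<open>gs ! j\<close>. One evaluation of it yields both the
  coefficients of the Cayley form, from identity matrices, and its transformation under the group
  action.\<close>

definition cayley_image :: "nat \<Rightarrow> nat \<Rightarrow> complex mat list \<Rightarrow> nat list ext" where
  "cayley_image d n gs = (\<lambda>R. \<Sum>\<pi>s\<in>{\<pi>s. length \<pi>s = d \<and> set \<pi>s \<subseteq> {\<pi>. \<pi> permutes {..<n}}}.
     of_int (sign (foldr (\<circ>) \<pi>s id)) * wedge_list (map ext_vector (map (\<lambda>i. pure_tensor d n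
       (map2 (\<lambda>g \<pi>. g *\<^sub>v unit_vec n (\<pi> i)) gs \<pi>s)) [0..<n])) R)"

lemma cayley_form_image: "cayley_form d n = cayley_image d n (replicate d (1\<^sub>m n))"
  unfolding cayley_form_def cayley_image_def cayley_term_def
proof (rule ext, intro sum.cong refl arg_cong2[where f="(*)"] fun_cong[where f="wedge_list _"]
    arg_cong[where f=wedge_list])
  fix \<pi>s :: "(nat \<Rightarrow> nat) list"
  assume "\<pi>s \<in> {\<pi>s. length \<pi>s = d \<and> set \<pi>s \<subseteq> {\<pi>. \<pi> permutes {..<n}}}"
  then have l: "length \<pi>s = d" by simp
  have "map2 (\<lambda>g \<pi>. g *\<^sub>v unit_vec n (\<pi> i)) (replicate d (1\<^sub>m n)) \<pi>s =
      (map (\<lambda>\<pi>. unit_vec n (\<pi> i)) \<pi>s :: complex vec list)" for i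
    using l by (intro nth_equalityI) (auto intro: one_mult_mat_vec[OF unit_vec_carrier])
  then show "map (\<lambda>i. ext_vector (pure_tensor d n (map (\<lambda>\<pi>. unit_vec n (\<pi> i)) \<pi>s))) [0..<n] =
      map ext_vector (map (\<lambda>i. pure_tensor d n
       (map2 (\<lambda>g \<pi>. g *\<^sub>v unit_vec n (\<pi> i)) (replicate d (1\<^sub>m n)) \<pi>s)) [0..<n])"
    by simp
qed

text \<open>The action is an algebra endomorphism, so it may be applied to each of the
  \<open>n\<close> wedge factors separately.\<close>

lemma act_cayley_image:
  assumes gs: "length gs = d" "set gs \<subseteq> carrier_mat n n"
  shows "act d n gs (cayley_form d n) = cayley_image d n gs"
proof -
  have "ext_map (tensor_index d n) (\<lambda>J. pure_tensor d n (map2 (\<lambda>g i. g *\<^sub>v unit_vec n i) gs J))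
      (cayley_term d n \<pi>s) = wedge_list (map ext_vector (map (\<lambda>i. pure_tensor d n
       (map2 (\<lambda>g \<pi>. g *\<^sub>v unit_vec n (\<pi> i)) gs \<pi>s)) [0..<n]))"
    if \<pi>s: "length \<pi>s = d" "set \<pi>s \<subseteq> {\<pi>. \<pi> permutes {..<n}}" for \<pi>s
  proof -
    have "ext_map (tensor_index d n) (\<lambda>J. pure_tensor d n (map2 (\<lambda>g i. g *\<^sub>v unit_vec n i) gs J))
        (ext_vector (pure_tensor d n (map (\<lambda>\<pi>. unit_vec n (\<pi> i)) \<pi>s))) =
        ext_vector (pure_tensor d n (map2 (\<lambda>g \<pi>. g *\<^sub>v unit_vec n (\<pi> i)) gs \<pi>s))" if i: "i < n" for i
    proof -
      \<comment> \<open>The factor is a single basis tensor, and \<open>J0\<close> is its index; the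
        sum in \<open>ext_map_ext_vector\<close> therefore reduces to one term.\<close>
      define J0 where "J0 = map (\<lambda>\<pi>. \<pi> i) \<pi>s"
      have "\<pi> i < n" if "\<pi> \<in> set \<pi>s" for \<pi>
        using \<pi>s that i permutes_in_image[of \<pi> "{..<n}" i] by auto
      then have J0: "J0 \<in> tensor_index d n" using \<pi>s by (auto simp: J0_def tensor_index_def)
      have e: "pure_tensor d n (map (\<lambda>\<pi>. unit_vec n (\<pi> i)) \<pi>s) J = (if J = J0 then 1 else 0)"
        if J: "J \<in> tensor_index d n" for J
      proof -
        have "pure_tensor d n (map (\<lambda>\<pi>. unit_vec n (\<pi> i)) \<pi>s) J = (\<Prod>j<d. if J ! j = J0 ! j then 1
            else 0)"
          using J J0 \<pi>s tensor_index_nth[OF J] tensor_index_nth[OF J0] unfolding pure_tensor_def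
          by (auto intro!: prod.cong simp: J0_def)
        also have "\<dots> = (if J = J0 then 1 else 0)"
        proof (cases "J = J0")
          case False
          then obtain j where "j < d" "J ! j \<noteq> J0 ! j"
            using J J0 by (auto simp: tensor_index_def list_eq_iff_nth_eq)
          then show ?thesis using False by auto
        qed simp
        finally show ?thesis .
      qed
      have "(\<Sum>J\<in>tensor_index d n. pure_tensor d n (map (\<lambda>\<pi>. unit_vec n (\<pi> i)) \<pi>s) J *
          pure_tensor d n (map2 (\<lambda>g i. g *\<^sub>v unit_vec n i) gs J) K) =
          (\<Sum>J\<in>tensor_index d n. if J = J0
            then pure_tensor d n (map2 (\<lambda>g i. g *\<^sub>v unit_vec n i) gs J) K else 0)" for K
        by (intro sum.cong refl) (simp add: e)
      then have "(\<Sum>J\<in>tensor_index d n. pure_tensor d n (map (\<lambda>\<pi>. unit_vec n (\<pi> i)) \<pi>s) J *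
          pure_tensor d n (map2 (\<lambda>g i. g *\<^sub>v unit_vec n i) gs J) K) =
          pure_tensor d n (map2 (\<lambda>g i. g *\<^sub>v unit_vec n i) gs J0) K" for K
        using J0 by (simp add: finite_tensor_index)
      moreover have "map2 (\<lambda>g i. g *\<^sub>v unit_vec n i) gs J0 =
          map2 (\<lambda>g \<pi>. g *\<^sub>v unit_vec n (\<pi> i)) gs \<pi>s"
        by (auto simp: J0_def zip_map2)
      ultimately show ?thesis by (simp add: ext_map_ext_vector finite_tensor_index)
    qed
    then show ?thesis
      by (auto simp: cayley_term_def ext_map_wedge_list finite_tensor_index comp_def
          intro!: arg_cong[where f = wedge_list])
  qed
  then show ?thesis
    unfolding act_def cayley_form_def cayley_image_def ext_map_sum
    by (intro ext sum.cong refl) simp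
qed

text \<open>
  For \<open>card R = n\<close> the determinant of this matrix is the sign of the map from \<open>i\<close> to the \<open>j\<close>-th entry
  of the \<open>i\<close>-th smallest element of \<open>R\<close> if this map permutes \<open>{..<n}\<close>, and \<open>0\<close> otherwise.
\<close>

definition slice_mat :: "nat \<Rightarrow> nat list set \<Rightarrow> nat \<Rightarrow> complex mat" where
  "slice_mat n R j = mat n n (\<lambda>(i, k). if sorted_list_of_set R ! i ! j = k then 1 else 0)"

text \<open>Expanding each wedge product as a minor introduces a permutation \<open>\<sigma>\<close>
  of the elements of \<open>R\<close>. For fixed \<open>\<sigma>\<close> the sum over the tuple
  factors into \<open>d\<close> determinants with rows permuted by \<open>\<sigma>\<close>. The
  resulting signs cancel for odd \<open>d\<close>, leaving \<open>n!\<close> equal terms.\<close>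

lemma cayley_image_eq:
  assumes gs: "length gs = d" "set gs \<subseteq> carrier_mat n n" and "odd d"
  shows "cayley_image d n gs R = (if R \<subseteq> tensor_index d n \<and> card R = n
    then fact n * (\<Prod>j<d. det (slice_mat n R j)) * (\<Prod>j<d. det (gs ! j)) else 0)"
proof -
  let ?P = "{\<pi>. \<pi> permutes {..<n}}"
  let ?L = "{\<pi>s. length \<pi>s = d \<and> set \<pi>s \<subseteq> ?P}"
  let ?xs = "\<lambda>\<pi>s. map (\<lambda>i. pure_tensor d n (map2 (\<lambda>g \<pi>. g *\<^sub>v unit_vec n (\<pi> i)) gs \<pi>s)) [0..<n]"
  show ?thesis
  proof (cases "R \<subseteq> tensor_index d n \<and> card R = n")
    case False
    have "wedge_list (map ext_vector (?xs \<pi>s)) R = 0" for \<pi>s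
    proof (cases "R \<subseteq> tensor_index d n")
      case True
      then have "finite R" using finite_tensor_index finite_subset by blast
      then show ?thesis using False True by (subst wedge_list_det) auto
    next
      case False
      have "set (map ext_vector (?xs \<pi>s)) \<subseteq> ext_algebra (tensor_index d n)"
        by (auto simp: ext_algebra_def ext_vector_def pure_tensor_def is_singleton_def split:
            if_splits)
      from wedge_list_in_ext_algebra[OF this] show ?thesis using False
          by (simp add: ext_algebra_def)
    qed
    then show ?thesis using False by (auto simp: cayley_image_def)
  next
    case True
    then have R: "finite R" "card R = n" "R \<subseteq> tensor_index d n"
      using finite_tensor_index finite_subset by blast+
    define rs where "rs = sorted_list_of_set R"
    have rs: "rs ! i \<in> tensor_index d n" if "i < n" for i
      using that R nth_mem[of i rs] by (auto simp: rs_def)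
    have gsj: "gs ! j \<in> carrier_mat n n" if "j < d" for j
      using that gs nth_mem[of j gs] by auto
    let ?A = "\<lambda>j. mat n n (\<lambda>(i, k). gs ! j $$ (rs ! i ! j, k))"
    have expand: "wedge_list (map ext_vector (?xs \<pi>s)) R =
        (\<Sum>\<sigma>\<in>?P. of_int (sign \<sigma>) * (\<Prod>j<d. \<Prod>i<n. gs ! j $$ (rs ! \<sigma> i ! j, (\<pi>s ! j) i)))"
      if \<pi>s: "\<pi>s \<in> ?L" for \<pi>s
    proof -
      \<comment> \<open>The Leibniz formula for the minor: \<open>\<sigma>\<close> assigns to the
        \<open>i\<close>-th factor the element \<open>rs ! \<sigma> i\<close>.\<close>
      have "wedge_list (map ext_vector (?xs \<pi>s)) R =
          (\<Sum>\<sigma>\<in>?P. of_int (sign \<sigma>) * (\<Prod>i<n. (?xs \<pi>s ! i) (rs ! \<sigma> i)))"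
        using R permutes_in_image unfolding rs_def
        by (subst wedge_list_det) (auto simp: det_def atLeast0LessThan intro!: sum.cong prod.cong)
      also have "\<dots> = (\<Sum>\<sigma>\<in>?P. of_int (sign \<sigma>) * (\<Prod>i<n. \<Prod>j<d. gs ! j $$ (rs ! \<sigma> i ! j, (\<pi>s ! j) i)))"
      proof (intro sum.cong refl arg_cong2[where f="(*)"] prod.cong)
        fix \<sigma> i assume "\<sigma> \<in> ?P" "i \<in> {..<n}"
        then have "\<sigma> i < n" "i < n" using permutes_in_image[of \<sigma> "{..<n}" i] by auto
        then show "(?xs \<pi>s ! i) (rs ! \<sigma> i) = (\<Prod>j<d. gs ! j $$ (rs ! \<sigma> i ! j, (\<pi>s ! j) i))"
          using pure_tensor_image[OF gs, of \<pi>s i "rs ! \<sigma> i"] \<pi>s rs by simp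
      qed
      also have "\<dots> = (\<Sum>\<sigma>\<in>?P. of_int (sign \<sigma>) * (\<Prod>j<d. \<Prod>i<n. gs ! j $$ (rs ! \<sigma> i ! j, (\<pi>s ! j) i)))"
        by (intro sum.cong refl arg_cong2[where f="(*)"] prod.swap)
      finally show ?thesis .
    qed
    have perm: "(\<Sum>\<pi>\<in>?P. of_int (sign \<pi>) * (\<Prod>i<n. gs ! j $$ (rs ! \<sigma> i ! j, \<pi> i))) =
        of_int (sign \<sigma>) * (det (slice_mat n R j) * det (gs ! j))" if j: "j < d" and \<sigma>: "\<sigma> \<in> ?P"
            for j \<sigma>
    proof -
      have "\<sigma> i < n" if "i < n" for i using \<sigma> that permutes_in_image[of \<sigma> "{..<n}" i] by auto
      then have "(\<Sum>\<pi>\<in>?P. of_int (sign \<pi>) * (\<Prod>i<n. gs ! j $$ (rs ! \<sigma> i ! j, \<pi> i))) =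
          det (mat n n (\<lambda>(i, k). ?A j $$ (\<sigma> i, k)))"
        using permutes_in_image
        by (auto simp: det_def atLeast0LessThan intro!: sum.cong prod.cong)
      also have "\<dots> = of_int (sign \<sigma>) * det (?A j)"
        using \<sigma> by (subst det_permute_rows) (auto simp: atLeast0LessThan)
      \<comment> \<open>Each row of the slice matrix is a standard basis row, so the product selects
        the rows of \<open>gs ! j\<close> named by the \<open>j\<close>-th entries of
        \<open>rs\<close>.\<close>
      also have "?A j = slice_mat n R j * gs ! j"
      proof (intro eq_matI)
        fix i k assume "i < dim_row (slice_mat n R j * gs ! j)" "k < dim_col (slice_mat n R j *
            gs ! j)"
        then have ik: "i < n" "k < n" using gsj[OF j] by (auto simp: slice_mat_def)
        have "(slice_mat n R j * gs ! j) $$ (i, k) =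
            (\<Sum>m\<in>{0..<n}. (if rs ! i ! j = m then 1 else 0) * gs ! j $$ (m, k))"
          using ik gsj[OF j] by (simp add: slice_mat_def scalar_prod_def rs_def)
        also have "\<dots> = (\<Sum>m\<in>{0..<n}. if rs ! i ! j = m then gs ! j $$ (m, k) else 0)"
          by (intro sum.cong) auto
        also have "\<dots> = gs ! j $$ (rs ! i ! j, k)"
          using tensor_index_nth[OF rs[OF ik(1)] j] by simp
        finally show "?A j $$ (i, k) = (slice_mat n R j * gs ! j) $$ (i, k)" using ik by simp
      qed (use gsj[OF j] in \<open>auto simp: slice_mat_def\<close>)
      also have "det \<dots> = det (slice_mat n R j) * det (gs ! j)"
        by (rule det_mult[OF _ gsj[OF j]]) (simp add: slice_mat_def)
      finally show ?thesis .
    qed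
    have "cayley_image d n gs R = (\<Sum>\<pi>s\<in>?L. \<Sum>\<sigma>\<in>?P. of_int (sign \<sigma>) *
        (\<Prod>j<d. of_int (sign (\<pi>s ! j)) * (\<Prod>i<n. gs ! j $$ (rs ! \<sigma> i ! j, (\<pi>s ! j) i))))"
      unfolding cayley_image_def
    proof (intro sum.cong refl)
      fix \<pi>s assume \<pi>s: "\<pi>s \<in> ?L"
      have "sign (foldr (\<circ>) \<pi>s id) = (\<Prod>j<d. sign (\<pi>s ! j))"
        using sign_foldr_comp(2)[of "{..<n}" \<pi>s] \<pi>s by auto
      then show "of_int (sign (foldr (\<circ>) \<pi>s id)) * wedge_list (map ext_vector (?xs \<pi>s)) R =
          (\<Sum>\<sigma>\<in>?P. of_int (sign \<sigma>) *
        (\<Prod>j<d. of_int (sign (\<pi>s ! j)) * (\<Prod>i<n. gs ! j $$ (rs ! \<sigma> i ! j, (\<pi>s ! j) i))))"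
        unfolding expand[OF \<pi>s] by (simp add: sum_distrib_left prod.distrib algebra_simps)
    qed
    also have "\<dots> = (\<Sum>\<sigma>\<in>?P. of_int (sign \<sigma>) * (\<Sum>\<pi>s\<in>?L.
        (\<Prod>j<d. of_int (sign (\<pi>s ! j)) * (\<Prod>i<n. gs ! j $$ (rs ! \<sigma> i ! j, (\<pi>s ! j) i)))))"
      by (subst sum.swap) (simp add: sum_distrib_left)
    \<comment> \<open>The entries of the tuple now vary independently, so the sum over tuples
      becomes a product over tensor positions.\<close>
    also have "\<dots> = (\<Sum>\<sigma>\<in>?P. of_int (sign \<sigma>) * (\<Prod>j<d. \<Sum>\<pi>\<in>?P.
        of_int (sign \<pi>) * (\<Prod>i<n. gs ! j $$ (rs ! \<sigma> i ! j, \<pi> i))))"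
      by (subst sum_lists_prod[where F = "\<lambda>j \<pi>. of_int (sign \<pi>) *
          (\<Prod>i<n. gs ! j $$ (rs ! _ i ! j, \<pi> i))"])
        (simp_all add: finite_permutations)
    also have "\<dots> = (\<Sum>\<sigma>\<in>?P. (\<Prod>j<d. det (slice_mat n R j)) * (\<Prod>j<d. det (gs ! j)))"
    proof (intro sum.cong refl)
      fix \<sigma> assume \<sigma>: "\<sigma> \<in> ?P"
      \<comment> \<open>One sign comes from the minor and one from each of the \<open>d\<close>
        determinants; \<open>d + 1\<close> is even.\<close>
      have "of_int (sign \<sigma>) * (of_int (sign \<sigma>)) ^ d = (1 :: complex)"
        using \<open>odd d\<close> by (cases \<sigma> rule: sign_cases) auto
      then show "of_int (sign \<sigma>) * (\<Prod>j<d. \<Sum>\<pi>\<in>?P.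
          of_int (sign \<pi>) * (\<Prod>i<n. gs ! j $$ (rs ! \<sigma> i ! j, \<pi> i))) =
          (\<Prod>j<d. det (slice_mat n R j)) * (\<Prod>j<d. det (gs ! j))"
        by (simp add: perm[OF _ \<sigma>] prod.distrib mult.assoc[symmetric])
    qed
    also have "\<dots> = fact n * (\<Prod>j<d. det (slice_mat n R j)) * (\<Prod>j<d. det (gs ! j))"
      using card_permutations[of "{..<n}" n] by (simp add: mult.assoc)
    finally show ?thesis using True by simp
  qed
qed

lemma cayley_form_eq:
  assumes "odd d"
  shows "cayley_form d n R = (if R \<subseteq> tensor_index d n \<and> card R = n
    then fact n * (\<Prod>j<d. det (slice_mat n R j)) else 0)"
  unfolding cayley_form_image
  by (subst cayley_image_eq) (use assms in \<open>auto simp: prod.neutral\<close>)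

text \<open>In \<open>cayley_image_eq\<close> the matrices enter only through the product of their
  determinants, so the Cayley form is a relative invariant.\<close>

lemma act_cayley_form:
  assumes "length gs = d" "set gs \<subseteq> carrier_mat n n" "odd d"
  shows "act d n gs (cayley_form d n) = (\<lambda>R. (\<Prod>j<d. det (gs ! j)) * cayley_form d n R)"
  by (rule ext) (simp add: act_cayley_image cayley_image_eq cayley_form_eq assms)

lemma cayley_form_in_ext_tensor: "odd d \<Longrightarrow> cayley_form d n \<in> ext_tensor d n"
  by (simp add: ext_algebra_def cayley_form_eq)

lemma act_cayley_map:
  assumes "length gs = d" "set gs \<subseteq> carrier_mat n n" "odd d"
  shows "act d n gs (cayley_map d n v) = (\<lambda>R. (\<Prod>j<d. det (gs ! j)) *
      cayley_map d n (act d n gs v) R)"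
proof -
  have "act d n gs (cayley_map d n v) = wedge (act d n gs (cayley_form d n)) (act d n gs v)"
    by (simp add: act_def cayley_map_def ext_map_wedge finite_tensor_index)
  then show ?thesis
    by (simp add: act_cayley_form assms wedge_scale_left cayley_map_def)
qed

section \<open>The action of diagonal matrices, and determinants\<close>

lemma pure_tensor_mult_unit:
  assumes "length gs = d" "set gs \<subseteq> carrier_mat n n" "J \<in> tensor_index d n"
  shows "pure_tensor d n (map2 (\<lambda>g i. g *\<^sub>v unit_vec n i) gs J) K =
    (if K \<in> tensor_index d n then \<Prod>j<d. gs ! j $$ (K ! j, J ! j) else 0)"
proof (cases "K \<in> tensor_index d n")
  case True
  have "(map2 (\<lambda>g i. g *\<^sub>v unit_vec n i) gs J ! j) $ (K ! j) = gs ! j $$ (K ! j, J ! j)"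
      if j: "j < d" for j
    using j assms tensor_index_nth[OF True j] tensor_index_nth[OF assms(3) j]
      subsetD[OF assms(2) nth_mem[of j gs]] by (auto simp: tensor_index_def)
  then show ?thesis using True by (simp add: pure_tensor_def)
qed (simp add: pure_tensor_def)

text \<open>Each basis tensor is an eigenvector of a diagonal tuple, so basis products are
  eigenvectors too, with the product of the eigenvalues.\<close>

lemma act_diagonal:
  "act d n (map (\<lambda>j. mat_diag n (a j)) [0..<d]) v S =
    (if S \<subseteq> tensor_index d n then (\<Prod>J\<in>S. \<Prod>j<d. a j (J ! j)) * v S else 0)"
proof -
  let ?gs = "map (\<lambda>j. mat_diag n (a j)) [0..<d]"
  have "pure_tensor d n (map2 (\<lambda>g i. g *\<^sub>v unit_vec n i) ?gs J) =
      (\<lambda>K. if K = J then \<Prod>j<d. a j (J ! j) else 0)" if J: "J \<in> tensor_index d n" for J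
  proof
    fix K
    have "pure_tensor d n (map2 (\<lambda>g i. g *\<^sub>v unit_vec n i) ?gs J) K =
        (if K \<in> tensor_index d n then \<Prod>j<d. ?gs ! j $$ (K ! j, J ! j) else 0)"
      by (rule pure_tensor_mult_unit) (use J in auto)
    also have "\<dots> = (if K = J then \<Prod>j<d. a j (J ! j) else 0)"
    proof (cases "K \<in> tensor_index d n")
      case True
      have "(\<Prod>j<d. ?gs ! j $$ (K ! j, J ! j)) = (\<Prod>j<d. if K ! j = J ! j then a j (J ! j) else 0)"
        using tensor_index_nth[OF True] tensor_index_nth[OF J]
        by (intro prod.cong) (auto simp: mat_diag_def)
      also have "\<dots> = (if K = J then \<Prod>j<d. a j (J ! j) else 0)"
      proof (cases "K = J")
        case False
        then obtain j where "j < d" "K ! j \<noteq> J ! j"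
          using J True by (auto simp: tensor_index_def list_eq_iff_nth_eq)
        then show ?thesis using False by auto
      qed simp
      finally show ?thesis using True by simp
    qed (use J in auto)
    finally show "pure_tensor d n (map2 (\<lambda>g i. g *\<^sub>v unit_vec n i) ?gs J) K =
        (if K = J then \<Prod>j<d. a j (J ! j) else 0)" .
  qed
  then have "act d n ?gs v = ext_map (tensor_index d n) (\<lambda>J K. if K = J then \<Prod>j<d. a j (J ! j)
      else 0) v"
    unfolding act_def by (intro ext_map_cong finite_tensor_index)
  then show ?thesis by (simp add: ext_map_diagonal finite_tensor_index)
qed

lemma det_mat_diag: "det (mat_diag n f) = (\<Prod>i<n. f i)"
proof -
  have "det (mat_diag n f) = prod_list (diag_mat (mat_diag n f))"
    by (rule det_upper_triangular[of _ n]) (auto simp: mat_diag_def)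
  also have "\<dots> = (\<Prod>i<n. f i)"
    by (simp add: prod_list_diag_prod atLeast0LessThan mat_diag_def)
  finally show ?thesis .
qed

lemma det_unitriangular: "g \<in> unitriangular n \<Longrightarrow> det g = 1"
  unfolding unitriangular_def
  by (auto simp: det_upper_triangular[of g n] prod_list_diag_prod)

section \<open>The Cayley map on highest weight vectors\<close>

text \<open>The determinant factor from \<open>act_cayley_map\<close> is the product of all
  \<open>a j i\<close> on diagonal tuples, which raises every weight entry by one, and it is 1 on
  unitriangular tuples.\<close>

lemma cayley_map_HWV:
  assumes "odd d" "v \<in> HWV d n \<mu>"
    and "\<And>j i. j < d \<Longrightarrow> i < n \<Longrightarrow> \<nu> ! j $ i = \<mu> ! j $ i + 1"
  shows "cayley_map d n v \<in> HWV d n \<nu>"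
proof -
  have v: "v \<in> ext_tensor d n" "is_weight_vector d n \<mu> v" "is_unitriangular_invariant d n v"
    using assms(2) by (auto simp: HWV_def)
  have "cayley_map d n v \<in> ext_tensor d n"
    unfolding cayley_map_def using v assms(1)
        by (intro wedge_in_ext_algebra cayley_form_in_ext_tensor)
  moreover have "is_weight_vector d n \<nu> (cayley_map d n v)"
    unfolding is_weight_vector_def
  proof (intro allI impI)
    fix a :: "nat \<Rightarrow> nat \<Rightarrow> complex" assume a: "\<forall>j<d. \<forall>i<n. a j i \<noteq> 0"
    let ?gs = "map (\<lambda>j. mat_diag n (a j)) [0..<d]"
    have "act d n ?gs (cayley_map d n v) =
        (\<lambda>R. (\<Prod>j<d. \<Prod>i<n. a j i) * cayley_map d n (act d n ?gs v) R)"
      by (subst act_cayley_map) (auto simp: assms det_mat_diag)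
    also have "act d n ?gs v = (\<lambda>S. (\<Prod>j<d. \<Prod>i<n. a j i powi ((\<mu> ! j) $ i)) * v S)"
      using v a unfolding is_weight_vector_def by auto
    also have "cayley_map d n \<dots> = (\<lambda>R. (\<Prod>j<d. \<Prod>i<n. a j i powi ((\<mu> ! j) $ i)) * cayley_map d n v R)"
      by (simp add: cayley_map_def wedge_scale_right)
    also have "(\<lambda>R. (\<Prod>j<d. \<Prod>i<n. a j i) * ((\<Prod>j<d. \<Prod>i<n. a j i powi ((\<mu> ! j) $ i)) *
        cayley_map d n v R)) =
        (\<lambda>R. (\<Prod>j<d. \<Prod>i<n. a j i * a j i powi ((\<mu> ! j) $ i)) * cayley_map d n v R)"
      by (simp add: prod.distrib mult.assoc)
    \<comment> \<open>Absorbing \<open>a j i\<close> into an integer power relies on the entries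
      being nonzero.\<close>
    also have "(\<Prod>j<d. \<Prod>i<n. a j i * a j i powi ((\<mu> ! j) $ i)) =
        (\<Prod>j<d. \<Prod>i<n. a j i powi ((\<nu> ! j) $ i))"
      using a assms(3) by (intro prod.cong refl) (auto simp: power_int_add)
    finally show "act d n ?gs (cayley_map d n v) = (\<lambda>S. (\<Prod>j<d. \<Prod>i<n. a j i powi ((\<nu> ! j) $ i)) *
        cayley_map d n v S)" .
  qed
  moreover have "is_unitriangular_invariant d n (cayley_map d n v)"
    unfolding is_unitriangular_invariant_def
  proof (intro allI impI)
    fix gs assume gs: "length gs = d \<and> set gs \<subseteq> unitriangular n"
    then have "set gs \<subseteq> carrier_mat n n" by (auto simp: unitriangular_def)
    then have "act d n gs (cayley_map d n v) = (\<lambda>R. (\<Prod>j<d. det (gs ! j)) *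
        cayley_map d n (act d n gs v) R)"
      using gs assms(1) by (intro act_cayley_map) auto
    also have "(\<Prod>j<d. det (gs ! j)) = 1"
      using gs nth_mem by (intro prod.neutral) (fastforce intro: det_unitriangular)
    also have "act d n gs v = v" using v gs by (auto simp: is_unitriangular_invariant_def)
    finally show "act d n gs (cayley_map d n v) = cayley_map d n v" by simp
  qed
  ultimately show ?thesis by (simp add: HWV_def)
qed

section \<open>Weights given by conjugate partitions\<close>

text \<open>The count also describes the padding: past the last column, \<open>i\<close> is at least
  the largest part \<open>hd p\<close>, so no part exceeds \<open>i\<close>.\<close>

lemma pad_conjugate_partition:
  assumes "is_partition p" "i < n"
  shows "pad n (conjugate_partition p) $ i = int (length (filter (\<lambda>x. i < x) p))"
proof -
  have "filter (\<lambda>x. i < x) p = []" if "\<not> i < hd p" "p \<noteq> []"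
    using assms(1) that by (cases p) (auto simp: is_partition_def filter_empty_conv)
  then show ?thesis using assms(2) by (auto simp: pad_def conjugate_partition_def)
qed

text \<open>A new part \<open>n\<close> lengthens each of the first \<open>n\<close> columns by one,
  which matches the determinant shift in \<open>cayley_map_HWV\<close>. The bound on the parts keeps
  the extended list weakly decreasing.\<close>

lemma pad_conjugate_partition_add_row:
  assumes "is_partition p" "i < n" "\<forall>x\<in>set p. x \<le> n"
  shows "pad n (conjugate_partition (add_row n p)) $ i = pad n (conjugate_partition p) $ i + 1"
proof -
  have "is_partition (add_row n p)"
    using assms by (auto simp: is_partition_def add_row_def)
  then show ?thesis using assms by (simp add: pad_conjugate_partition) (simp add: add_row_def)
qed

lemma cayley_map_HWV_partition:
  assumes "odd d" "length lam = d" "\<forall>p\<in>set lam. is_partition p \<and> (\<forall>x\<in>set p. x \<le> n)"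
  shows "cayley_map d n \<in> HWV_partition d n (map conjugate_partition lam)
    \<rightarrow> HWV_partition d n (map conjugate_partition (map (add_row n) lam))"
  unfolding HWV_partition_def
  by (intro funcsetI cayley_map_HWV[OF assms(1)], assumption)
    (use assms in \<open>auto intro!: pad_conjugate_partition_add_row\<close>)

section \<open>Weight vectors supported on a smaller tensor space\<close>

lemma tensor_index_mono: "k \<le> l \<Longrightarrow> tensor_index d k \<subseteq> tensor_index d l"
  by (auto simp: tensor_index_def)

text \<open>If some index in \<open>S\<close> has an entry \<open>i \<ge> k\<close> in position
  \<open>j\<close>, scaling only that coordinate by 2 fixes \<open>v\<close>, as the weight there is
  0, yet multiplies its coefficient at \<open>S\<close> by a positive power of 2.\<close>

lemma weight_vector_support:
  assumes "v \<in> ext_tensor d l" "is_weight_vector d l \<mu> v"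
    and zero: "\<And>j i. j < d \<Longrightarrow> k \<le> i \<Longrightarrow> i < l \<Longrightarrow> \<mu> ! j $ i = 0"
  shows "v \<in> ext_tensor d k"
  unfolding ext_algebra_def
proof (intro CollectI allI impI)
  fix S assume Sk: "\<not> S \<subseteq> tensor_index d k"
  show "v S = 0"
  proof (cases "S \<subseteq> tensor_index d l")
    case False
    then show ?thesis using assms(1) by (simp add: ext_algebra_def)
  next
    case True
    then have fin: "finite S" using finite_tensor_index finite_subset by blast
    from Sk obtain J0 where J0: "J0 \<in> S" "J0 \<notin> tensor_index d k" by auto
    then have J0l: "J0 \<in> tensor_index d l" using True by auto
    with J0 obtain j0 where j0: "j0 < d" "k \<le> J0 ! j0"
      by (force simp: tensor_index_def in_set_conv_nth)
    have i0: "J0 ! j0 < l" using tensor_index_nth[OF J0l j0(1)] .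
    \<comment> \<open>The factor 2 affects only the basis vector number \<open>J0 ! j0\<close> in
      tensor position \<open>j0\<close>; \<open>?m\<close> counts its occurrences in
      \<open>S\<close>.\<close>
    define a :: "nat \<Rightarrow> nat \<Rightarrow> complex" where
      "a = (\<lambda>j i. if j = j0 then (if i = J0 ! j0 then 2 else 1) else 1)"
    let ?m = "card {J \<in> S. J ! j0 = J0 ! j0}"
    have "(\<Prod>J\<in>S. \<Prod>j<d. a j (J ! j)) = (\<Prod>J\<in>S. if J ! j0 = J0 ! j0 then 2 else 1)"
      using j0 by (intro prod.cong refl) (simp add: a_def)
    also have "\<dots> = 2 ^ ?m"
      using fin by (simp add: prod.If_cases Int_def)
    finally have 1: "(\<Prod>J\<in>S. \<Prod>j<d. a j (J ! j)) = of_nat (2 ^ ?m)" by simp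
    have 2: "(\<Prod>j<d. \<Prod>i<l. a j i powi ((\<mu> ! j) $ i)) = 1"
      using zero j0 i0 by (intro prod.neutral) (auto simp: a_def intro!: prod.neutral)
    have "(\<forall>j<d. \<forall>i<l. a j i \<noteq> 0)" by (simp add: a_def)
    then have "act d l (map (\<lambda>j. mat_diag l (a j)) [0..<d]) v S = v S"
      using assms(2) unfolding is_weight_vector_def by (auto simp: 2)
    then have *: "of_nat (2 ^ ?m) * v S = v S" using True
        by (simp add: act_diagonal 1 del: of_nat_power)
    have "?m > 0" using J0 fin by (auto simp: card_gt_0_iff)
    then have "(2::nat) ^ ?m \<noteq> 1" by simp
    then have "of_nat (2 ^ ?m) \<noteq> (1::complex)" using of_nat_eq_1_iff by blast
    then show ?thesis using * by auto
  qed
qed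

text \<open>The zero weight entries confine \<open>v\<close> to the smaller exterior algebra. There
  the smaller group acts as its embedding into the larger one by identity blocks, so both conditions
  are inherited.\<close>

lemma HWV_restrict:
  assumes kl: "k \<le> l" and v: "v \<in> HWV d l \<mu>"
    and zero: "\<And>j i. j < d \<Longrightarrow> k \<le> i \<Longrightarrow> i < l \<Longrightarrow> \<mu> ! j $ i = 0"
    and eq: "\<And>j i. j < d \<Longrightarrow> i < k \<Longrightarrow> \<nu> ! j $ i = \<mu> ! j $ i"
  shows "v \<in> HWV d k \<nu>"
proof -
  have v: "v \<in> ext_tensor d l" "is_weight_vector d l \<mu> v" "is_unitriangular_invariant d l v"
    using v by (auto simp: HWV_def)
  have vk: "v \<in> ext_tensor d k" using weight_vector_support[OF v(1,2) zero] .
  have "is_weight_vector d k \<nu> v"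
    unfolding is_weight_vector_def
  proof (intro allI impI ext)
    fix a :: "nat \<Rightarrow> nat \<Rightarrow> complex" and S assume a: "\<forall>j<d. \<forall>i<k. a j i \<noteq> 0"
    \<comment> \<open>Diagonal matrices are extended by ones, which change neither the eigenvalue at
      \<open>S\<close> nor the weight character.\<close>
    define b where "b = (\<lambda>j i. if i < k then a j i else 1)"
    show "act d k (map (\<lambda>j. mat_diag k (a j)) [0..<d]) v S =
        (\<Prod>j<d. \<Prod>i<k. a j i powi ((\<nu> ! j) $ i)) * v S"
    proof (cases "S \<subseteq> tensor_index d k")
      case False
      then show ?thesis using vk by (simp add: act_diagonal ext_algebra_def)
    next
      case True
      have "act d k (map (\<lambda>j. mat_diag k (a j)) [0..<d]) v S = (\<Prod>J\<in>S. \<Prod>j<d. a j (J ! j)) * v S"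
        using True by (simp add: act_diagonal)
      also have "(\<Prod>J\<in>S. \<Prod>j<d. a j (J ! j)) = (\<Prod>J\<in>S. \<Prod>j<d. b j (J ! j))"
        using True tensor_index_nth by (intro prod.cong refl) (auto simp: b_def)
      also have "\<dots> * v S = act d l (map (\<lambda>j. mat_diag l (b j)) [0..<d]) v S"
        using True tensor_index_mono[OF kl, of d] by (simp add: act_diagonal)
      also have "\<dots> = (\<Prod>j<d. \<Prod>i<l. b j i powi ((\<mu> ! j) $ i)) * v S"
        using v(2) a unfolding is_weight_vector_def by (simp add: b_def)
      also have "(\<Prod>j<d. \<Prod>i<l. b j i powi ((\<mu> ! j) $ i)) = (\<Prod>j<d. \<Prod>i<k. a j i powi ((\<nu> ! j) $ i))"
      proof (rule prod.cong[OF refl])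
        fix j assume "j \<in> {..<d}"
        then have "(\<Prod>i<k. a j i powi ((\<nu> ! j) $ i)) = (\<Prod>i<k. b j i powi ((\<mu> ! j) $ i))"
          by (intro prod.cong refl) (simp add: b_def eq)
        also have "\<dots> = (\<Prod>i<l. b j i powi ((\<mu> ! j) $ i))"
          by (rule prod.mono_neutral_left) (use kl in \<open>auto simp: b_def\<close>)
        finally show "(\<Prod>i<l. b j i powi ((\<mu> ! j) $ i)) = (\<Prod>i<k. a j i powi ((\<nu> ! j) $ i))" by simp
      qed
      finally show ?thesis .
    qed
  qed
  moreover have "is_unitriangular_invariant d k v"
    unfolding is_unitriangular_invariant_def
  proof (intro allI impI)
    fix gs assume gs: "length gs = d \<and> set gs \<subseteq> unitriangular k"
    \<comment> \<open>The block diagonal extension of \<open>g\<close> by an identity block remains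
      unitriangular.\<close>
    define h where "h = (\<lambda>g. mat l l (\<lambda>(i, j). if i < k \<and> j < k then g $$ (i, j) else if i = j
        then 1 else (0::complex)))"
    have h: "h g \<in> unitriangular l" if "g \<in> unitriangular k" for g
      using that kl by (auto simp: h_def unitriangular_def upper_triangular_def)
    have hgs: "set (map h gs) \<subseteq> carrier_mat l l" by (auto simp: h_def)
    have gsc: "set gs \<subseteq> carrier_mat k k" using gs by (auto simp: unitriangular_def)
    let ?f = "\<lambda>J. pure_tensor d k (map2 (\<lambda>g i. g *\<^sub>v unit_vec k i) gs J)"
    let ?h = "\<lambda>J. pure_tensor d l (map2 (\<lambda>g i. g *\<^sub>v unit_vec l i) (map h gs) J)"
    have "?h J = ?f J" if J: "J \<in> tensor_index d k" for J
    proof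
      fix K
      have Jl: "J \<in> tensor_index d l" using J tensor_index_mono[OF kl] by auto
      have 1: "?h J K = (if K \<in> tensor_index d l then \<Prod>j<d. map h gs ! j $$ (K ! j, J ! j) else 0)"
        using gs hgs Jl by (intro pure_tensor_mult_unit) auto
      have 2: "?f J K = (if K \<in> tensor_index d k then \<Prod>j<d. gs ! j $$ (K ! j, J ! j) else 0)"
        using gs gsc J by (intro pure_tensor_mult_unit) auto
      consider (both) "K \<in> tensor_index d k" | (neither) "K \<notin> tensor_index d l"
        | (large) "K \<in> tensor_index d l" "K \<notin> tensor_index d k"
        by blast
      then show "?h J K = ?f J K"
      proof cases
        case both
        then have "K \<in> tensor_index d l" using tensor_index_mono[OF kl] by auto
        moreover have "(\<Prod>j<d. map h gs ! j $$ (K ! j, J ! j)) = (\<Prod>j<d. gs ! j $$ (K ! j, J ! j))"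
          using gs kl tensor_index_nth[OF both] tensor_index_nth[OF J]
          by (intro prod.cong) (auto simp: h_def less_le_trans[OF _ kl])
        ultimately show ?thesis using both by (simp only: 1 2 if_True)
      next
        case neither
        then show ?thesis using tensor_index_mono[OF kl, of d] by (auto simp: 1 2)
      next
        \<comment> \<open>A column of the extension with index below \<open>k\<close> has zeros in
          all rows from \<open>k\<close> on, so no new basis tensor arises.\<close>
        case large
        then obtain j where j: "j < d" "k \<le> K ! j"
          by (force simp: tensor_index_def in_set_conv_nth)
        then have "map h gs ! j $$ (K ! j, J ! j) = 0"
          using gs tensor_index_nth[OF large(1) j(1)] tensor_index_nth[OF J j(1)] kl
              by (simp add: h_def)
        then have "(\<Prod>j<d. map h gs ! j $$ (K ! j, J ! j)) = 0" using j by auto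
        then show ?thesis using large by (simp only: 1 2 if_True if_False)
      qed
    qed
    then have "act d k gs v = ext_map (tensor_index d k) ?h v"
      unfolding act_def by (intro ext_map_cong[symmetric] finite_tensor_index)
    \<comment> \<open>The additional summands belong to sets outside
      \<open>tensor_index d k\<close>, where \<open>v\<close> vanishes.\<close>
    also have "\<dots> = act d l (map h gs) v"
      unfolding act_def ext_map_basis_image using vk tensor_index_mono[OF kl, of d]
      by (intro ext sum.mono_neutral_left) (auto simp: finite_tensor_index ext_algebra_def)
    also have "\<dots> = v"
    proof -
      have "length (map h gs) = d" "set (map h gs) \<subseteq> unitriangular l" using gs h by auto
      then show ?thesis using v(3) unfolding is_unitriangular_invariant_def by blast
    qed
    finally show "act d k gs v = v" .
  qed
  ultimately show ?thesis using vk by (simp add: HWV_def)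
qed

section \<open>Comparing the Cayley maps in two dimensions\<close>

text \<open>The list \<open>replicate d i\<close> is the index of the basis tensor with
  \<open>e\<^sub>i\<close> in every position.\<close>

definition diagonal_indices :: "nat \<Rightarrow> nat \<Rightarrow> nat \<Rightarrow> nat list set" where
  "diagonal_indices d k l = replicate d ` {k..<l}"

lemma diagonal_indices_disjoint: "d > 0 \<Longrightarrow> diagonal_indices d k l \<inter> tensor_index d k = {}"
  by (auto simp: diagonal_indices_def tensor_index_def)

lemma finite_diagonal_indices: "finite (diagonal_indices d k l)"
  by (simp add: diagonal_indices_def)

lemma card_diagonal_indices: "d > 0 \<Longrightarrow> card (diagonal_indices d k l) = l - k"
  by (auto simp: diagonal_indices_def card_image inj_on_def)

text \<open>The first entries, below \<open>k\<close> and at least \<open>k\<close>, already decide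
  the lexicographic comparison. The new indices thus follow all old ones, which controls both the
  row order of slice matrices and the wedge signs.\<close>

lemma tensor_index_less_diagonal:
  "d > 0 \<Longrightarrow> J \<in> tensor_index d k \<Longrightarrow> K \<in> diagonal_indices d k l \<Longrightarrow> J < K"
  by (cases d; cases J) (auto simp: tensor_index_def diagonal_indices_def)

lemma sorted_list_of_set_Un_diagonal:
  assumes "d > 0" "S \<subseteq> tensor_index d k"
  shows "sorted_list_of_set (S \<union> diagonal_indices d k l) =
      sorted_list_of_set S @ map (replicate d) [k..<l]"
proof -
  have fin: "finite S" using assms(2) finite_tensor_index finite_subset by blast
  have "replicate d i < replicate d j" if "i < j" for i j :: nat
    using that assms(1) by (cases d) auto
  then have "sorted_wrt (<) (map (replicate d) [k..<l])"
    by (auto simp: sorted_wrt_map intro: sorted_wrt_mono_rel[OF _ sorted_wrt_upt])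
  moreover have "set (map (replicate d) [k..<l]) = diagonal_indices d k l"
    by (simp add: diagonal_indices_def)
  ultimately have "sorted_wrt (<) (sorted_list_of_set S @ map (replicate d) [k..<l])"
    using tensor_index_less_diagonal[OF assms(1)] assms(2) fin
    unfolding sorted_wrt_append by auto
  moreover have "set (sorted_list_of_set S @ map (replicate d) [k..<l]) =
      S \<union> diagonal_indices d k l"
    using fin by (simp add: diagonal_indices_def)
  ultimately show ?thesis
    using fin finite_diagonal_indices
    by (intro strict_sorted_equal) (auto simp del: sorted_list_of_set_range)
qed

text \<open>Adjoining the diagonal indices extends every slice matrix by an identity block, which
  preserves its determinant; only the factorial in \<open>cayley_form_eq\<close> changes.\<close>

lemma cayley_form_Un_diagonal:
  assumes "odd d" "k \<le> l" "S \<subseteq> tensor_index d k"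
  shows "cayley_form d l (S \<union> diagonal_indices d k l) = fact l / fact k * cayley_form d k S"
proof -
  let ?D = "diagonal_indices d k l"
  have d: "d > 0" using assms(1) by (cases d) auto
  have fin: "finite S" using assms(3) finite_tensor_index finite_subset by blast
  have sub: "S \<union> ?D \<subseteq> tensor_index d l"
    using assms(3) tensor_index_mono[OF assms(2), of d]
        by (auto simp: diagonal_indices_def tensor_index_def)
  have "S \<inter> ?D = {}" using diagonal_indices_disjoint[OF d, of k l] assms(3) by auto
  then have card: "card (S \<union> ?D) = card S + (l - k)"
    using fin finite_diagonal_indices by (simp add: card_Un_disjoint card_diagonal_indices d)
  show ?thesis
  proof (cases "card S = k")
    case False
    then have "card (S \<union> ?D) \<noteq> l" using card assms(2) by arith
    then show ?thesis using False assms(1) by (simp add: cayley_form_eq)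
  next
    case True
    have "det (slice_mat l (S \<union> ?D) j) = det (slice_mat k S j)" if j: "j < d" for j
    proof -
      let ?ss = "sorted_list_of_set S"
      have ss: "?ss ! i ! j < k" if "i < k" for i
        using that fin True assms(3) nth_mem[of i ?ss] j by (auto intro!: tensor_index_nth)
      \<comment> \<open>Row \<open>i \<ge> k\<close> comes from \<open>replicate d i\<close>, whose
        \<open>j\<close>-th entry is \<open>i\<close>; the first \<open>k\<close> rows come from
        \<open>S\<close> and have their ones in columns below \<open>k\<close>.\<close>
      have "slice_mat l (S \<union> ?D) j = four_block_mat (slice_mat k S j) (0\<^sub>m k (l - k)) (0\<^sub>m (l - k)
          k) (1\<^sub>m (l - k))"
      proof (intro eq_matI)
        fix i m assume "i < dim_row (four_block_mat (slice_mat k S j) (0\<^sub>m k (l - k)) (0\<^sub>m (l - k)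
            k) (1\<^sub>m (l - k)))"
          "m < dim_col (four_block_mat (slice_mat k S j) (0\<^sub>m k (l - k)) (0\<^sub>m (l - k) k) (1\<^sub>m (l -
            k)))"
        then have im: "i < l" "m < l" using assms(2) by (auto simp: slice_mat_def)
        show "slice_mat l (S \<union> ?D) j $$ (i, m) =
            four_block_mat (slice_mat k S j) (0\<^sub>m k (l - k)) (0\<^sub>m (l - k) k) (1\<^sub>m (l - k)) $$ (i, m)"
        proof (cases "i < k")
          case i: True
          then have "(?ss @ map (replicate d) [k..<l]) ! i = ?ss ! i"
            using fin True by (simp add: nth_append)
          then show ?thesis
            using i im ss[OF i] unfolding slice_mat_def sorted_list_of_set_Un_diagonal[OF d
                assms(3)]
            by auto
        next
          case i: False
          then have "(?ss @ map (replicate d) [k..<l]) ! i ! j = i"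
            using im fin True j by (simp add: nth_append)
          then show ?thesis
            using i im unfolding slice_mat_def sorted_list_of_set_Un_diagonal[OF d assms(3)]
            by auto
        qed
      qed (use assms(2) in \<open>auto simp: slice_mat_def\<close>)
      also have "det \<dots> = det (slice_mat k S j) * det (1\<^sub>m (l - k))"
        by (rule det_four_block_mat_upper_right_zero) (auto simp: slice_mat_def)
      finally show ?thesis by simp
    qed
    then show ?thesis using card True assms sub by (simp add: cayley_form_eq)
  qed
qed

text \<open>As \<open>v\<close> has no coefficient at sets meeting the diagonal indices, these must
  all lie in the Cayley factor. The extra sign is uniform because the Cayley form for
  \<open>k\<close> lives on sets of size \<open>k\<close>.\<close>

lemma cayley_map_Un_diagonal:
  assumes "odd d" "k \<le> l" "v \<in> ext_tensor d k" "R \<subseteq> tensor_index d k"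
  shows "cayley_map d l v (R \<union> diagonal_indices d k l) =
    (-1) ^ ((l - k) * (card R - k)) * (fact l / fact k) * cayley_map d k v R"
proof -
  let ?D = "diagonal_indices d k l"
  let ?c = "(-1) ^ ((l - k) * (card R - k)) * (fact l / fact k) :: complex"
  have d: "d > 0" using assms(1) by (cases d) auto
  have fin: "finite R" using assms(4) finite_tensor_index finite_subset by blast
  have disj: "R \<inter> ?D = {}" using diagonal_indices_disjoint[OF d, of k l] assms(4) by auto
  let ?t = "\<lambda>S. (-1) ^ inversions S (R \<union> ?D - S) * cayley_form d l S * v (R \<union> ?D - S)"
  have "cayley_map d l v (R \<union> ?D) = (\<Sum>S\<in>(\<lambda>S. S \<union> ?D) ` Pow R. ?t S)"
    unfolding cayley_map_def wedge_inversions
  proof (rule sum.mono_neutral_right)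
    show "\<forall>S\<in>Pow (R \<union> ?D) - (\<lambda>S. S \<union> ?D) ` Pow R. ?t S = 0"
    proof
      fix S assume S: "S \<in> Pow (R \<union> ?D) - (\<lambda>S. S \<union> ?D) ` Pow R"
      have "\<not> ?D \<subseteq> S"
      proof
        assume "?D \<subseteq> S"
        then have "S = (S \<inter> R) \<union> ?D" using S by auto
        then show False using S by auto
      qed
      then have "\<not> R \<union> ?D - S \<subseteq> tensor_index d k" using diagonal_indices_disjoint[OF d, of k l]
          by auto
      then show "?t S = 0" using assms(3) by (simp add: ext_algebra_def)
    qed
  qed (use fin finite_diagonal_indices in auto)
  also have "\<dots> = (\<Sum>S\<in>Pow R. ?t (S \<union> ?D))"
    using disj by (subst sum.reindex) (auto simp: inj_on_def)
  also have "\<dots> = (\<Sum>S\<in>Pow R. ?c * ((-1) ^ inversions S (R - S) * cayley_form d k S * v (R - S)))"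
  proof (intro sum.cong refl)
    fix S assume "S \<in> Pow R"
    then have S: "S \<subseteq> R" by simp
    then have Sf: "finite S" "S \<subseteq> tensor_index d k" using fin finite_subset assms(4) by auto
    have e: "R \<union> ?D - (S \<union> ?D) = R - S" using disj S by auto
    \<comment> \<open>Every diagonal index exceeds every element of \<open>R - S\<close>, so all
      these pairs are inversions.\<close>
    have "{(s, t). s \<in> ?D \<and> t \<in> R - S \<and> t < s} = ?D \<times> (R - S)"
      using tensor_index_less_diagonal[OF d] assms(4) by fastforce
    then have "inversions ?D (R - S) = (l - k) * card (R - S)"
      by (simp add: inversions_def card_cartesian_product card_diagonal_indices d)
    moreover have "inversions (S \<union> ?D) (R - S) = inversions S (R - S) + inversions ?D (R - S)"
      by (rule inversions_Un_left) (use Sf fin disj S finite_diagonal_indices in auto)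
    ultimately have i: "inversions (S \<union> ?D) (R - S) = inversions S (R - S) + (l - k) *
        card (R - S)" by simp
    show "?t (S \<union> ?D) = ?c * ((-1) ^ inversions S (R - S) * cayley_form d k S * v (R - S))"
    \<comment> \<open>For \<open>card S = k\<close> the truncated difference
      \<open>card R - k\<close> is the true size of \<open>R - S\<close>; otherwise both Cayley
      coefficients vanish and the exponent is irrelevant.\<close>
    proof (cases "card S = k")
      case True
      then have "card (R - S) = card R - k" using S Sf by (simp add: card_Diff_subset)
      then show ?thesis
        unfolding e i cayley_form_Un_diagonal[OF assms(1,2) Sf(2)] by (simp add: power_add)
    next
      case False
      then show ?thesis
        unfolding e cayley_form_Un_diagonal[OF assms(1,2) Sf(2)] using assms(1)
            by (simp add: cayley_form_eq)
    qed
  qed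
  also have "\<dots> = ?c * cayley_map d k v R"
    by (simp add: cayley_map_def wedge_inversions sum_distrib_left)
  finally show ?thesis .
qed

text \<open>Functions in HOL are total, so the function space memberships express that the maps land
  in the stated target spaces.\<close>

theorem theorem1p10:
  fixes d k :: nat and lam :: "nat list list"
  assumes "odd d" and "d \<ge> 3" and "k > 0"
    and "length lam = d"
    and "\<forall>p\<in>set lam. is_partition p \<and> in_rectangle p (k ^ (d - 1)) k"
    and "inj_on (cayley_map d k) (HWV_partition d k (map conjugate_partition lam))"
  shows "cayley_map d k \<in> HWV_partition d k (map conjugate_partition lam)
            \<rightarrow> HWV_partition d k (map conjugate_partition (map (add_row k) lam)) \<and>
         (\<forall>l>k. cayley_map d l \<in> HWV_partition d l (map conjugate_partition lam)
            \<rightarrow> HWV_partition d l (map conjugate_partition (map (add_row l) lam)) \<and>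
           inj_on (cayley_map d l) (HWV_partition d l (map conjugate_partition lam)))"
proof (intro conjI allI impI)
  have lam: "is_partition p" "\<forall>x\<in>set p. x \<le> k" if "p \<in> set lam" for p
    using that assms(5) by (auto simp: in_rectangle_def)
  have lam_n: "\<forall>p\<in>set lam. is_partition p \<and> (\<forall>x\<in>set p. x \<le> n)" if "k \<le> n" for n
    using lam that by (meson le_trans)
  show "cayley_map d k \<in> HWV_partition d k (map conjugate_partition lam)
      \<rightarrow> HWV_partition d k (map conjugate_partition (map (add_row k) lam))"
    using assms(1,4) lam_n by (intro cayley_map_HWV_partition) auto
  fix l assume kl: "k < l"
  then have "k \<le> l" by simp
  show "cayley_map d l \<in> HWV_partition d l (map conjugate_partition lam)
      \<rightarrow> HWV_partition d l (map conjugate_partition (map (add_row l) lam))"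
    using assms(1,4) lam_n[OF \<open>k \<le> l\<close>] by (intro cayley_map_HWV_partition) auto
  have restrict: "v \<in> HWV_partition d k (map conjugate_partition lam)"
    if v: "v \<in> HWV_partition d l (map conjugate_partition lam)" for v
    unfolding HWV_partition_def
  proof (rule HWV_restrict[OF \<open>k \<le> l\<close> v[unfolded HWV_partition_def]])
    fix j i assume j: "j < d"
    then have p: "lam ! j \<in> set lam" using assms(4) by simp
    show "map (pad l) (map conjugate_partition lam) ! j $ i = 0" if "k \<le> i" "i < l"
    proof -
      \<comment> \<open>All parts are at most \<open>k\<close>, so no column with index
        \<open>i \<ge> k\<close> is occupied and the weight entry is 0.\<close>
      have "filter ((<) i) (lam ! j) = []" using lam(2)[OF p] that by (auto simp: filter_empty_conv)
      then show ?thesis using j p that assms(4) lam(1) by (simp add: pad_conjugate_partition)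
    qed
    show "map (pad k) (map conjugate_partition lam) ! j $ i =
        map (pad l) (map conjugate_partition lam) ! j $ i"
      if "i < k"
      using j p that kl assms(4) lam(1) by (simp add: pad_conjugate_partition)
  qed
  show "inj_on (cayley_map d l) (HWV_partition d l (map conjugate_partition lam))"
  proof (rule inj_onI)
    fix v w assume v: "v \<in> HWV_partition d l (map conjugate_partition lam)"
      and w: "w \<in> HWV_partition d l (map conjugate_partition lam)"
      and eq: "cayley_map d l v = cayley_map d l w"
    have ext: "v \<in> ext_tensor d k" "w \<in> ext_tensor d k"
      using restrict[OF v] restrict[OF w] by (auto simp: HWV_partition_def HWV_def)
    have "cayley_map d k v R = cayley_map d k w R" for R
    proof (cases "R \<subseteq> tensor_index d k")
      case True
      \<comment> \<open>Equality of the larger images is read off at \<open>R\<close> with the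
        diagonal indices adjoined; the common scalar is nonzero and cancels.\<close>
      have "(-1) ^ ((l - k) * (card R - k)) * (fact l / fact k) * cayley_map d k v R =
          (-1) ^ ((l - k) * (card R - k)) * (fact l / fact k) * cayley_map d k w R"
        using cayley_map_Un_diagonal[OF assms(1) \<open>k \<le> l\<close> ext(1) True]
          cayley_map_Un_diagonal[OF assms(1) \<open>k \<le> l\<close> ext(2) True] eq by simp
      then show ?thesis by simp
    next
      case False
      have "cayley_map d k v \<in> ext_tensor d k" "cayley_map d k w \<in> ext_tensor d k"
        unfolding cayley_map_def
        using ext assms(1) by (auto intro: wedge_in_ext_algebra cayley_form_in_ext_tensor)
      then show ?thesis using False by (simp add: ext_algebra_def)
    qed
    then show "v = w"
      using inj_onD[OF assms(6) _ restrict[OF v] restrict[OF w]] by blast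
  qed
qed

end
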